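(* Let $\theta\in\mathbb{R}\setminus\mathbb{Q}$, let $q\in\mathbb{Q}\cup\{\infty\}$, and let ${}^{\bullet}\mathbb{R}$ be given a section topology $\tau_{\theta,\sigma,q}$. Then the group ${}^{\ast}\mathbb{Z}(\theta)\subset{}^{\bullet}\mathbb{R}$, acting on ${}^{\bullet}\mathbb{R}$ by translation, acts properly discontinuously by homeomorphisms which permute isometrically the leaves of ${}^{\bullet}\mathbb{R}$ and preserve the distinguished transversal ${}^{\ast}\mathbb{Z}_{q}$. The quotient $\hat{\mathbb{R}}_{q}/{}^{\ast}\mathbb{Z}(\theta)$, where $\hat{\mathbb{R}}_{q}=({}^{\bullet}\mathbb{R},\mathbb{R},{}^{\ast}\mathbb{Z}_{q})$, is a foliation with distinguished transversal canonically isomorphic to $(\mathbb{T}^{2},L(\theta),\mathbb{T}_{q})$, i.e. to the Kronecker foliation $\mathfrak{F}(\theta)$ of slope $\theta$ with distinguished transversal $\mathbb{T}_{q}$.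
   Context: Fix a non-principal ultrafilter $\mathfrak{u}$ on $\mathbb{N}$, with ultrapowers ${}^{\ast}\mathbb{Z}\subset{}^{\ast}\mathbb{R}$; ${}^{\ast}\mathbb{R}_{\varepsilon}\subset{}^{\ast}\mathbb{R}$ is the group of infinitesimals, and ${}^{\bullet}\mathbb{R}={}^{\ast}\mathbb{R}/{}^{\ast}\mathbb{R}_{\varepsilon}$, which contains $\mathbb{R}$ and ${}^{\ast}\mathbb{Z}$. Its leaves are the cosets ${}^{\bullet}r+\mathbb{R}$, each with the topology and metric of $\mathbb{R}$. Put ${}^{\ast}\mathbb{Z}(\theta)=\{{}^{\ast}n\in{}^{\ast}\mathbb{Z}\mid\exists\,{}^{\ast}n^{\perp}\in{}^{\ast}\mathbb{Z},\ \theta\,{}^{\ast}n-{}^{\ast}n^{\perp}\in{}^{\ast}\mathbb{R}_{\varepsilon}\}$. Let $\mathbb{T}=\mathbb{R}/\mathbb{Z}$. The Kronecker foliation $\mathfrak{F}(\theta)=(\mathbb{T}^2,L(\theta))$ is the foliation of $\mathbb{T}^{2}$ by the cosets of the one-parameter subgroup $L(\theta)$, the image in $\mathbb{T}^{2}$ of the line $\{(r,\theta r)\mid r\in\mathbb{R}\}$. For $q\in\mathbb{Q}\cup\{\infty\}$, $\mathbb{T}_{q}\subset\mathbb{T}^{2}$ is the image of the line through $0$ of slope $q$ (so $\mathbb{T}_{\infty}=\{0\}\times\mathbb{T}$). Let $\mathbb{Z}_{q}=\{r\in\mathbb{R}\mid \overline{(r,r\theta)}\in\mathbb{T}_{q}\}$,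 where the bar denotes the class in $\mathbb{T}^{2}$; it is a discrete group isomorphic to $\mathbb{Z}$ (with $\mathbb{Z}_{\infty}=\mathbb{Z}$). Its ultrapower ${}^{\ast}\mathbb{Z}_{q}$ embeds in ${}^{\bullet}\mathbb{R}$ and there contains ${}^{\ast}\mathbb{Z}(\theta)$. The map $s:{}^{\ast}\mathbb{Z}_{q}\to\mathbb{T}_{q}$ sending the class of $\{r_i\}$ to the $\mathfrak{u}$-limit of $\overline{(r_i,r_i\theta)}$ is an epimorphism with kernel ${}^{\ast}\mathbb{Z}(\theta)$. $\mathbb{Z}_{q}$ acts on ${}^{\ast}\mathbb{Z}_{q}$ by translation and on $\mathbb{T}_{q}$ by translation through $s$. Section topology: choose a $\mathbb{Z}_{q}$-equivariant section $\sigma:\mathbb{T}_{q}\to{}^{\ast}\mathbb{Z}_{q}$ of $s$ with $\sigma(0)=0$. Then $(t,{}^{\ast}n)\mapsto\sigma(t)+{}^{\ast}n$ is a bijection $\mathbb{T}_{q}\times{}^{\ast}\mathbb{Z}(\theta)\to{}^{\ast}\mathbb{Z}_{q}$; give $\mathbb{T}_{q}$ its usual topology, ${}^{\ast}\mathbb{Z}(\theta)$ the discrete topology, and ${}^{\ast}\mathbb{Z}_{q}$ the resulting product topology. Finally ${}^{\bullet}\mathbb{R}=(\mathbb{R}\times{}^{\ast}\mathbb{Z}_{q})/\mathbb{Z}_{q}$, where $n\cdot(r,m)=(r-n,m+n)$ and the class of $(r,m)$ corresponds to $r+m$; give ${}^{\bullet}\mathbb{R}$ the quotient of the product topology. This topology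 is $\tau_{\theta,\sigma,q}$; it makes ${}^{\bullet}\mathbb{R}$ a (non second countable) foliation. *)

theory Defs
  imports
    "HOL-Analysis.Analysis"
    "HOL-Algebra.Coset"
    "HOL-Library.Function_Algebras"
begin

section \<open>Quotient topologies\<close>

definition quotient_topology :: "'a topology \<Rightarrow> ('a \<Rightarrow> 'b) \<Rightarrow> 'b topology" where
  "quotient_topology X f =
     topology (\<lambda>U. U \<subseteq> f ` topspace X \<and> openin X {x \<in> topspace X. f x \<in> U})"

lemma openin_quotient_topology:
  "openin (quotient_topology X f) U \<longleftrightarrow>
     U \<subseteq> f ` topspace X \<and> openin X {x \<in> topspace X. f x \<in> U}"
proof -
  have "istopology (\<lambda>U. U \<subseteq> f ` topspace X \<and> openin X {x \<in> topspace X. f x \<in> U})"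
    unfolding istopology_def
  proof (intro conjI allI impI)
    fix S T
    assume S: "S \<subseteq> f ` topspace X \<and> openin X {x \<in> topspace X. f x \<in> S}"
      and T: "T \<subseteq> f ` topspace X \<and> openin X {x \<in> topspace X. f x \<in> T}"
    have "{x \<in> topspace X. f x \<in> S \<inter> T}
        = {x \<in> topspace X. f x \<in> S} \<inter> {x \<in> topspace X. f x \<in> T}"
      by blast
    then show "openin X {x \<in> topspace X. f x \<in> S \<inter> T}"
      using S T by (simp add: openin_Int)
    show "S \<inter> T \<subseteq> f ` topspace X"
      using S by blast
  next
    fix K
    assume K: "\<forall>S\<in>K. S \<subseteq> f ` topspace X \<and> openin X {x \<in> topspace X. f x \<in> S}"
    have "{x \<in> topspace X. f x \<in> \<Union>K} = (\<Union>S\<in>K. {x \<in> topspace X. f x \<in> S})"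
      by blast
    then show "openin X {x \<in> topspace X. f x \<in> \<Union>K}"
      using K by auto
    show "\<Union>K \<subseteq> f ` topspace X"
      using K by blast
  qed
  then show ?thesis
    by (simp add: quotient_topology_def)
qed

lemma topspace_quotient_topology: "topspace (quotient_topology X f) = f ` topspace X"
proof (rule antisym)
  show "topspace (quotient_topology X f) \<subseteq> f ` topspace X"
    using openin_topspace[of "quotient_topology X f"]
    unfolding openin_quotient_topology by (rule conjunct1)
  have "{x \<in> topspace X. f x \<in> f ` topspace X} = topspace X"
    by blast
  then have "openin (quotient_topology X f) (f ` topspace X)"
    by (simp add: openin_quotient_topology)
  then show "f ` topspace X \<subseteq> topspace (quotient_topology X f)"
    by (rule openin_subset)
qed

lemma quotient_map_quotient_topology: "quotient_map X (quotient_topology X f) f"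
  by (simp add: quotient_map_def openin_quotient_topology topspace_quotient_topology)


section \<open>Foliations with distinguished transversal\<close>

text \<open>
  A foliation is recorded as its total space together with its leaves.  Each leaf is a
  topological space of its own: its intrinsic topology is in general strictly finer than the
  one induced by the total space.
\<close>

record 'a foliated =
  fol_space :: "'a topology"
  fol_leaves :: "'a topology set"

record 'a transversed = "'a foliated" +
  dist_leaf :: "'a topology"
  dist_transversal :: "'a set"

text \<open>
  The leaves have dimension one, and so have the transversals.  A chart identifies \<open>U\<close> with
  the product of an interval \<open>V\<close> (the leaf direction) and an open set \<open>W\<close> of reals (the
  transverse direction); each plaque is open in some leaf, and there the chart is also a
  homeomorphism for the intrinsic topology.
\<close>

definition foliated_chart ::
  "('a, 'b) foliated_scheme \<Rightarrow> 'a set \<Rightarrow> real set \<Rightarrow> real set \<Rightarrow> ('a \<Rightarrow> real \<times> real) \<Rightarrow> bool" where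
  "foliated_chart F U V W \<phi> \<longleftrightarrow>
     openin (fol_space F) U \<and> open V \<and> is_interval V \<and> open W \<and>
     homeomorphic_map (subtopology (fol_space F) U) (top_of_set (V \<times> W)) \<phi> \<and>
     (\<forall>w\<in>W. \<exists>L\<in>fol_leaves F.
        openin L {x \<in> U. snd (\<phi> x) = w} \<and>
        homeomorphic_map (subtopology L {x \<in> U. snd (\<phi> x) = w}) (top_of_set (V \<times> {w})) \<phi>)"

definition foliation :: "('a, 'b) foliated_scheme \<Rightarrow> bool" where
  "foliation F \<longleftrightarrow>
     Hausdorff_space (fol_space F) \<and>
     (\<Union>L\<in>fol_leaves F. topspace L) = topspace (fol_space F) \<and>
     (\<forall>L\<in>fol_leaves F. connected_space L \<and> topspace L \<noteq> {}) \<and>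
     (\<forall>L\<in>fol_leaves F. \<forall>M\<in>fol_leaves F. L \<noteq> M \<longrightarrow> topspace L \<inter> topspace M = {}) \<and>
     (\<forall>x\<in>topspace (fol_space F). \<exists>U V W \<phi>. x \<in> U \<and> foliated_chart F U V W \<phi>)"

definition transversal :: "('a, 'b) foliated_scheme \<Rightarrow> 'a set \<Rightarrow> bool" where
  "transversal F T \<longleftrightarrow>
     T \<subseteq> topspace (fol_space F) \<and>
     (\<forall>x\<in>T. \<exists>U V W \<phi> v. x \<in> U \<and> foliated_chart F U V W \<phi> \<and> v \<in> V \<and>
        T \<inter> U = {y \<in> U. fst (\<phi> y) = v})"

definition foliation_with_transversal :: "('a, 'b) transversed_scheme \<Rightarrow> bool" where
  "foliation_with_transversal F \<longleftrightarrow>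
     foliation F \<and> dist_leaf F \<in> fol_leaves F \<and> transversal F (dist_transversal F)"

definition foliation_iso ::
  "('a, 'c) transversed_scheme \<Rightarrow> ('b, 'd) transversed_scheme \<Rightarrow> ('a \<Rightarrow> 'b) \<Rightarrow> bool" where
  "foliation_iso F G f \<longleftrightarrow>
     homeomorphic_map (fol_space F) (fol_space G) f \<and>
     (\<forall>L\<in>fol_leaves F. \<exists>M\<in>fol_leaves G. homeomorphic_map L M f) \<and>
     (\<forall>M\<in>fol_leaves G. \<exists>L\<in>fol_leaves F. homeomorphic_map L M f) \<and>
     homeomorphic_map (dist_leaf F) (dist_leaf G) f \<and>
     f ` dist_transversal F = dist_transversal G"

definition quotient_transversed :: "'a transversed \<Rightarrow> ('a \<Rightarrow> 'b) \<Rightarrow> 'b transversed" where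
  "quotient_transversed F p =
     \<lparr> fol_space = quotient_topology (fol_space F) p,
       fol_leaves = (\<lambda>L. quotient_topology L p) ` fol_leaves F,
       dist_leaf = quotient_topology (dist_leaf F) p,
       dist_transversal = p ` dist_transversal F \<rparr>"

text \<open>
  Two notions of proper discontinuity are in use: every point has a neighbourhood that is
  disjoint from all its nontrivial translates, and every compact set meets only finitely many
  of its translates.  Both are required.
\<close>

definition properly_discontinuous ::
  "('g, 'c) monoid_scheme \<Rightarrow> 'a topology \<Rightarrow> ('g \<Rightarrow> 'a \<Rightarrow> 'a) \<Rightarrow> bool" where
  "properly_discontinuous G X act \<longleftrightarrow>
     (\<forall>x\<in>topspace X. \<exists>U. openin X U \<and> x \<in> U \<and>
        (\<forall>g\<in>carrier G. g \<noteq> \<one>\<^bsub>G\<^esub> \<longrightarrow> act g ` U \<inter> U = {})) \<and>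
     (\<forall>K. compactin X K \<longrightarrow> finite {g \<in> carrier G. act g ` K \<inter> K \<noteq> {}})"


section \<open>The torus and the Kronecker foliation\<close>

definition additive_group :: "'a::ab_group_add monoid" where
  "additive_group = \<lparr> carrier = UNIV, mult = (+), one = 0 \<rparr>"

definition circle :: "real set monoid" where
  "circle = additive_group Mod \<int>"

definition torus :: "(real set \<times> real set) monoid" where
  "torus = circle \<times>\<times> circle"

definition to_circle :: "real \<Rightarrow> real set" where
  "to_circle x = \<int> #>\<^bsub>additive_group\<^esub> x"

definition to_torus :: "real \<Rightarrow> real \<Rightarrow> real set \<times> real set" where
  "to_torus x y = (to_circle x, to_circle y)"

definition circle_topology :: "real set topology" where
  "circle_topology = quotient_topology euclideanreal to_circle"

definition torus_topology :: "(real set \<times> real set) topology" where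
  "torus_topology = prod_topology circle_topology circle_topology"

datatype slope = Slope rat | Infinite_Slope

fun torus_line :: "slope \<Rightarrow> (real set \<times> real set) set" where
  "torus_line (Slope q) = {to_torus x (of_rat q * x) | x. True}"
| "torus_line Infinite_Slope = {to_torus 0 y | y. True}"

definition kronecker_leaf :: "real \<Rightarrow> real set \<times> real set \<Rightarrow> (real set \<times> real set) topology" where
  "kronecker_leaf \<theta> t = quotient_topology euclideanreal (\<lambda>r. t \<otimes>\<^bsub>torus\<^esub> to_torus r (\<theta> * r))"

definition kronecker :: "real \<Rightarrow> slope \<Rightarrow> (real set \<times> real set) transversed" where
  "kronecker \<theta> q =
     \<lparr> fol_space = torus_topology,
       fol_leaves = kronecker_leaf \<theta> ` carrier torus,
       dist_leaf = kronecker_leaf \<theta> \<one>\<^bsub>torus\<^esub>,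
       dist_transversal = torus_line q \<rparr>"


section \<open>Ultrapowers\<close>

definition nonprincipal_ultrafilter :: "nat filter \<Rightarrow> bool" where
  "nonprincipal_ultrafilter \<UU> \<longleftrightarrow>
     \<UU> \<noteq> bot \<and>
     (\<forall>P. eventually P \<UU> \<or> eventually (\<lambda>i. \<not> P i) \<UU>) \<and>
     (\<forall>n. eventually (\<lambda>i. i \<noteq> n) \<UU>)"

type_synonym hyper = "(nat \<Rightarrow> real) set"
type_synonym bullet = "hyper set"

text \<open>
  The additive group of the ultrapower of the reals: sequences modulo those vanishing almost
  everywhere.
\<close>

definition hyper_null :: "nat filter \<Rightarrow> (nat \<Rightarrow> real) set" where
  "hyper_null \<UU> = {x. eventually (\<lambda>i. x i = 0) \<UU>}"

definition hyperreals :: "nat filter \<Rightarrow> hyper monoid" where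
  "hyperreals \<UU> = additive_group Mod hyper_null \<UU>"

definition hyper_class :: "nat filter \<Rightarrow> (nat \<Rightarrow> real) \<Rightarrow> hyper" where
  "hyper_class \<UU> x = hyper_null \<UU> #>\<^bsub>additive_group\<^esub> x"

definition ultrapower :: "nat filter \<Rightarrow> real set \<Rightarrow> hyper set" where
  "ultrapower \<UU> A = {hyper_class \<UU> x | x. \<forall>i. x i \<in> A}"

definition infinitesimals :: "nat filter \<Rightarrow> hyper set" where
  "infinitesimals \<UU> =
     {hyper_class \<UU> x | x. \<forall>e>0. eventually (\<lambda>i. \<bar>x i\<bar> < e) \<UU>}"

definition bullet_reals :: "nat filter \<Rightarrow> bullet monoid" where
  "bullet_reals \<UU> = hyperreals \<UU> Mod infinitesimals \<UU>"

definition to_bullet :: "nat filter \<Rightarrow> hyper \<Rightarrow> bullet" where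
  "to_bullet \<UU> X = infinitesimals \<UU> #>\<^bsub>hyperreals \<UU>\<^esub> X"

definition of_standard :: "nat filter \<Rightarrow> real \<Rightarrow> bullet" where
  "of_standard \<UU> r = to_bullet \<UU> (hyper_class \<UU> (\<lambda>i. r))"

definition bullet_leaf :: "nat filter \<Rightarrow> bullet \<Rightarrow> bullet topology" where
  "bullet_leaf \<UU> x = quotient_topology euclideanreal (\<lambda>r. x \<otimes>\<^bsub>bullet_reals \<UU>\<^esub> of_standard \<UU> r)"

definition bullet_leaves :: "nat filter \<Rightarrow> bullet topology set" where
  "bullet_leaves \<UU> = bullet_leaf \<UU> ` carrier (bullet_reals \<UU>)"

text \<open>The metric of the reals on each leaf; it is meaningful only for points of the same leaf.\<close>

definition leaf_dist :: "nat filter \<Rightarrow> bullet \<Rightarrow> bullet \<Rightarrow> real" where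
  "leaf_dist \<UU> x y =
     (THE d. \<exists>r. y = x \<otimes>\<^bsub>bullet_reals \<UU>\<^esub> of_standard \<UU> r \<and> d = \<bar>r\<bar>)"

text \<open>
  The next two subsets are formed in the ultrapower of the reals; both embed in the quotient
  by the infinitesimals, and the images there are what is used.
\<close>

definition hyper_Z_theta :: "nat filter \<Rightarrow> real \<Rightarrow> hyper set" where
  "hyper_Z_theta \<UU> \<theta> =
     {hyper_class \<UU> n | n. (\<forall>i. n i \<in> \<int>) \<and>
        (\<exists>m. (\<forall>i. m i \<in> \<int>) \<and> hyper_class \<UU> (\<lambda>i. \<theta> * n i - m i) \<in> infinitesimals \<UU>)}"

definition Z_slope :: "real \<Rightarrow> slope \<Rightarrow> real set" where
  "Z_slope \<theta> q = {r. to_torus r (r * \<theta>) \<in> torus_line q}"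

definition bullet_Z_theta :: "nat filter \<Rightarrow> real \<Rightarrow> bullet set" where
  "bullet_Z_theta \<UU> \<theta> = to_bullet \<UU> ` hyper_Z_theta \<UU> \<theta>"

definition bullet_Z_slope :: "nat filter \<Rightarrow> real \<Rightarrow> slope \<Rightarrow> bullet set" where
  "bullet_Z_slope \<UU> \<theta> q = to_bullet \<UU> ` ultrapower \<UU> (Z_slope \<theta> q)"

definition limit_map :: "nat filter \<Rightarrow> real \<Rightarrow> slope \<Rightarrow> bullet \<Rightarrow> real set \<times> real set" where
  "limit_map \<UU> \<theta> q m =
     (THE t. \<exists>r. (\<forall>i. r i \<in> Z_slope \<theta> q) \<and> m = to_bullet \<UU> (hyper_class \<UU> r) \<and>
        limitin torus_topology (\<lambda>i. to_torus (r i) (r i * \<theta>)) t \<UU>)"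


section \<open>Section topologies\<close>

definition equivariant_section ::
  "nat filter \<Rightarrow> real \<Rightarrow> slope \<Rightarrow> (real set \<times> real set \<Rightarrow> bullet) \<Rightarrow> bool" where
  "equivariant_section \<UU> \<theta> q \<sigma> \<longleftrightarrow>
     (\<forall>t\<in>torus_line q. \<sigma> t \<in> bullet_Z_slope \<UU> \<theta> q \<and> limit_map \<UU> \<theta> q (\<sigma> t) = t) \<and>
     (\<forall>t\<in>torus_line q. \<forall>n\<in>Z_slope \<theta> q.
        \<sigma> (limit_map \<UU> \<theta> q (of_standard \<UU> n) \<otimes>\<^bsub>torus\<^esub> t)
          = of_standard \<UU> n \<otimes>\<^bsub>bullet_reals \<UU>\<^esub> \<sigma> t) \<and>
     \<sigma> \<one>\<^bsub>torus\<^esub> = \<one>\<^bsub>bullet_reals \<UU>\<^esub>"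

text \<open>
  The map below is a bijection from the product, so the topology is the product topology
  transported along it.
\<close>

definition transversal_topology ::
  "nat filter \<Rightarrow> real \<Rightarrow> slope \<Rightarrow> (real set \<times> real set \<Rightarrow> bullet) \<Rightarrow> bullet topology" where
  "transversal_topology \<UU> \<theta> q \<sigma> =
     quotient_topology
       (prod_topology (subtopology torus_topology (torus_line q))
          (discrete_topology (bullet_Z_theta \<UU> \<theta>)))
       (\<lambda>(t, n). \<sigma> t \<otimes>\<^bsub>bullet_reals \<UU>\<^esub> n)"

text \<open>
  The fibres of the addition map below are exactly the orbits of the action
  \<open>n \<cdot> (r, m) = (r - n, m + n)\<close>, so this is the quotient topology for that action.
\<close>

definition section_topology ::
  "nat filter \<Rightarrow> real \<Rightarrow> slope \<Rightarrow> (real set \<times> real set \<Rightarrow> bullet) \<Rightarrow> bullet topology" where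
  "section_topology \<UU> \<theta> q \<sigma> =
     quotient_topology
       (prod_topology euclideanreal (transversal_topology \<UU> \<theta> q \<sigma>))
       (\<lambda>(r, m). of_standard \<UU> r \<otimes>\<^bsub>bullet_reals \<UU>\<^esub> m)"

definition bullet_foliation ::
  "nat filter \<Rightarrow> real \<Rightarrow> slope \<Rightarrow> (real set \<times> real set \<Rightarrow> bullet) \<Rightarrow> bullet transversed" where
  "bullet_foliation \<UU> \<theta> q \<sigma> =
     \<lparr> fol_space = section_topology \<UU> \<theta> q \<sigma>,
       fol_leaves = bullet_leaves \<UU>,
       dist_leaf = bullet_leaf \<UU> \<one>\<^bsub>bullet_reals \<UU>\<^esub>,
       dist_transversal = bullet_Z_slope \<UU> \<theta> q \<rparr>"

definition orbit_map :: "nat filter \<Rightarrow> real \<Rightarrow> bullet \<Rightarrow> bullet set" where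
  "orbit_map \<UU> \<theta> x = bullet_Z_theta \<UU> \<theta> #>\<^bsub>bullet_reals \<UU>\<^esub> x"

definition quotient_of_bullet ::
  "nat filter \<Rightarrow> real \<Rightarrow> slope \<Rightarrow> (real set \<times> real set \<Rightarrow> bullet) \<Rightarrow> bullet set transversed" where
  "quotient_of_bullet \<UU> \<theta> q \<sigma> =
     quotient_transversed (bullet_foliation \<UU> \<theta> q \<sigma>) (orbit_map \<UU> \<theta>)"

end

theory Submission
  imports Defs
begin

text \<open>
  The bullet reals are an extension of the torus by \<open>\<^sup>*\<int>(\<theta>)\<close>, and a section topology
  makes them a product.

  Sending the class of a sequence \<open>x\<close> to the limit of \<open>(x i, x i * \<theta>)\<close> along the
  ultrafilter is a homomorphism \<open>line_limit\<close> to the torus.  Its kernel is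
  \<open>\<^sup>*\<int>(\<theta>)\<close> (\<open>line_limit_kernel\<close>): the limit is zero exactly when \<open>x\<close> and
  \<open>\<theta> * x\<close> are infinitely close to sequences of integers \<open>n\<close> and \<open>m\<close>, and
  then \<open>\<theta> * n - m\<close> is infinitesimal.  On the standard reals it parametrizes the leaf
  through zero, the transversal of the bullet reals is the full preimage of the line of slope
  \<open>q\<close> (\<open>bullet_Z_slope_iff\<close>), and there it agrees with \<open>limit_map\<close>.

  A point of the torus is a sum \<open>(r, r * \<theta>) + t\<close> with \<open>t\<close> on the line of slope
  \<open>q\<close>, and \<open>(r, t)\<close> is unique up to the action of \<open>\<int>\<^sub>q\<close>.  Equivariance of
  \<open>\<sigma>\<close> says precisely that \<open>(r, r * \<theta>) + t \<mapsto> r + \<sigma> t\<close> is well defined; it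
  is a section of \<open>line_limit\<close> over the whole torus (\<open>global_section_eq\<close>).  Adding
  elements of the kernel to it gives a bijection from torus times kernel to the bullet reals.
  Both sides are quotients of the product of the reals, the line of slope \<open>q\<close> and the
  discrete kernel, so this bijection is a homeomorphism
  (\<open>homeomorphic_map_trivialization\<close>).

  Thus the bullet reals are a discrete family of copies of the torus, which the kernel permutes
  simply transitively; the action is properly discontinuous, and \<open>line_limit\<close> is, up to a
  homeomorphism, the projection to the orbit space.  It carries the parametrization of each leaf
  by the reals to the parametrization of a Kronecker leaf, so it induces an isomorphism from the
  quotient to the Kronecker foliation (\<open>foliation_iso_orbit_limit\<close>).  That the quotient
  is a foliation is then transported from the torus
  (\<open>foliation_with_transversal_pullback\<close>), where the linear coordinates along the
  directions of slopes \<open>\<theta>\<close> and \<open>q\<close> give the charts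
  (\<open>kronecker_chart_exists\<close>).
\<close>

section \<open>The torus and the bullet reals as quotient groups\<close>

lemma comm_group_additive_group: "comm_group (additive_group :: 'a::ab_group_add monoid)"
proof (rule comm_groupI)
  fix x :: 'a
  show "\<exists>y\<in>carrier additive_group. y \<otimes>\<^bsub>additive_group\<^esub> x = \<one>\<^bsub>additive_group\<^esub>"
    by (rule bexI[of _ "- x"]) (simp_all add: additive_group_def)
qed (simp_all add: additive_group_def add_ac)

lemma carrier_additive_group [simp]: "carrier additive_group = UNIV"
  and mult_additive_group [simp]: "x \<otimes>\<^bsub>additive_group\<^esub> y = x + y"
  and one_additive_group [simp]: "\<one>\<^bsub>additive_group\<^esub> = 0"
  by (simp_all add: additive_group_def)

lemma inv_additive_group [simp]: "inv\<^bsub>additive_group\<^esub> x = - (x :: 'a::ab_group_add)"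
proof -
  interpret comm_group "additive_group :: 'a monoid" by (rule comm_group_additive_group)
  show ?thesis by (rule inv_equality) simp_all
qed

lemma subgroup_additive_group:
  fixes H :: "'a::ab_group_add set"
  assumes "0 \<in> H" "\<And>x y. x \<in> H \<Longrightarrow> y \<in> H \<Longrightarrow> x - y \<in> H"
  shows "subgroup H additive_group"
proof -
  have minus: "- x \<in> H" if "x \<in> H" for x
    using assms(2)[OF assms(1) that] by simp
  have "x + y \<in> H" if "x \<in> H" "y \<in> H" for x y
    using assms(2)[OF that(1) minus[OF that(2)]] by simp
  with assms(1) minus show ?thesis by (auto intro!: subgroup.intro)
qed

context comm_group
begin

lemma FactGroup_rcos_mult:
  assumes "subgroup H G" "x \<in> carrier G" "y \<in> carrier G"
  shows "(H #> x) \<otimes>\<^bsub>G Mod H\<^esub> (H #> y) = H #> (x \<otimes> y)"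
  using normal.rcos_sum[OF subgroup_imp_normal] assms by (simp add: FactGroup_def)

lemma rcos_eq_iff:
  assumes "subgroup H G" "x \<in> carrier G" "y \<in> carrier G"
  shows "H #> x = H #> y \<longleftrightarrow> x \<otimes> inv y \<in> H"
proof
  assume "H #> x = H #> y"
  then have "x \<in> H #> y" using rcos_self[OF assms(2,1)] by simp
  then obtain h where h: "h \<in> H" "x = h \<otimes> y" by (auto simp: r_coset_def)
  have "h \<in> carrier G" by (rule subgroup.mem_carrier[OF assms(1) h(1)])
  then show "x \<otimes> inv y \<in> H" using h assms by (simp add: m_assoc)
next
  assume h: "x \<otimes> inv y \<in> H"
  have "x \<otimes> inv y \<otimes> y \<in> H #> y" using h by (auto simp: r_coset_def)
  then have "x \<in> H #> y" using assms by (simp add: m_assoc)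
  then show "H #> x = H #> y" using repr_independence[OF _ assms(3,1)] by blast
qed

lemma carrier_FactGroup_image: "carrier (G Mod H) = (\<lambda>x. H #> x) ` carrier G"
  by (auto simp: FactGroup_def RCOSETS_def)

end

lemma subgroup_Ints: "subgroup (\<int> :: real set) additive_group"
  by (rule subgroup_additive_group) auto

lemma to_circle_eq_iff: "to_circle x = to_circle y \<longleftrightarrow> x - y \<in> \<int>"
  using comm_group.rcos_eq_iff[OF comm_group_additive_group subgroup_Ints, of x y]
  by (simp add: to_circle_def)

lemma mult_circle: "to_circle x \<otimes>\<^bsub>circle\<^esub> to_circle y = to_circle (x + y)"
  using comm_group.FactGroup_rcos_mult[OF comm_group_additive_group subgroup_Ints, of x y]
  by (simp add: to_circle_def circle_def)

lemma carrier_circle: "carrier circle = range to_circle"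
  using comm_group.carrier_FactGroup_image[OF comm_group_additive_group, of "\<int> :: real set"]
  by (simp add: to_circle_def[abs_def] circle_def)

lemma to_circle_0: "to_circle 0 = \<int>"
  using group.coset_mult_one[of "additive_group :: real monoid" \<int>] comm_group_additive_group
  by (auto simp: to_circle_def comm_group_def)

lemma one_circle: "\<one>\<^bsub>circle\<^esub> = to_circle 0"
  by (simp add: to_circle_0 circle_def FactGroup_def)

lemma to_torus_eq_iff: "to_torus x y = to_torus x' y' \<longleftrightarrow> x - x' \<in> \<int> \<and> y - y' \<in> \<int>"
  by (simp add: to_torus_def to_circle_eq_iff)

lemma mult_torus [simp]:
  "to_torus x y \<otimes>\<^bsub>torus\<^esub> to_torus x' y' = to_torus (x + x') (y + y')"
  by (simp add: to_torus_def torus_def mult_circle)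

lemma one_torus: "\<one>\<^bsub>torus\<^esub> = to_torus 0 0"
  by (simp add: to_torus_def torus_def one_circle)

lemma carrier_torus: "carrier torus = {to_torus x y | x y. True}"
  by (auto simp: to_torus_def torus_def carrier_circle)

lemma to_torus_in_carrier [simp, intro]: "to_torus x y \<in> carrier torus"
  by (auto simp: carrier_torus)

lemma carrier_torusE:
  assumes "t \<in> carrier torus" obtains x y where "t = to_torus x y"
  using assms by (auto simp: carrier_torus)

lemma comm_group_torus: "comm_group torus"
proof -
  have "comm_group circle"
    unfolding circle_def
    by (rule comm_group.abelian_FactGroup[OF comm_group_additive_group subgroup_Ints])
  then interpret comm_group circle .
  have "group torus"
    unfolding torus_def by (rule DirProd_group[OF is_group is_group])
  then show ?thesis
    by (rule group.group_comm_groupI) (auto simp: torus_def m_comm)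
qed

text \<open>
  A filter with a cluster point that decides every property converges to that point; this gives
  the limits along an ultrafilter.
\<close>

lemma ultrafilter_tendsto_compact:
  fixes f :: "nat \<Rightarrow> 'a::topological_space"
  assumes "nonprincipal_ultrafilter \<UU>" "compact K" "\<And>i. f i \<in> K"
  obtains l where "l \<in> K" "(f \<longlongrightarrow> l) \<UU>"
proof -
  have ne: "filtermap f \<UU> \<noteq> bot"
    using assms(1) by (simp add: nonprincipal_ultrafilter_def filtermap_bot_iff)
  have "eventually (\<lambda>x. x \<in> K) (filtermap f \<UU>)"
    using assms(3) by (simp add: eventually_filtermap)
  with ne assms(2) obtain l where l: "l \<in> K" "inf (nhds l) (filtermap f \<UU>) \<noteq> bot"
    unfolding compact_filter by blast
  have "(f \<longlongrightarrow> l) \<UU>"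
  proof (rule topological_tendstoI, rule ccontr)
    fix S assume S: "open S" "l \<in> S" and "\<not> eventually (\<lambda>i. f i \<in> S) \<UU>"
    then have "eventually (\<lambda>i. f i \<notin> S) \<UU>"
      using assms(1) by (auto simp: nonprincipal_ultrafilter_def)
    then have "eventually (\<lambda>x. x \<notin> S) (filtermap f \<UU>)"
      by (simp add: eventually_filtermap)
    moreover have "eventually (\<lambda>x. x \<in> S) (nhds l)"
      using S by (simp add: eventually_nhds_in_open)
    ultimately have "eventually (\<lambda>x. False) (inf (nhds l) (filtermap f \<UU>))"
      unfolding eventually_inf by blast
    with l(2) show False by (simp add: trivial_limit_def)
  qed
  with l(1) that show ?thesis by blast
qed

text \<open>
  The composite of the two quotient maps identifies the bullet reals with the real sequences
  modulo the sequences that tend to zero along the ultrafilter.  All computations with elements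
  of the bullet reals are done on such sequences.
\<close>

definition bullet_of :: "nat filter \<Rightarrow> (nat \<Rightarrow> real) \<Rightarrow> bullet" where
  "bullet_of \<UU> x = to_bullet \<UU> (hyper_class \<UU> x)"

lemma subgroup_hyper_null: "subgroup (hyper_null \<UU>) additive_group"
proof (rule subgroup_additive_group)
  fix x y assume "x \<in> hyper_null \<UU>" "y \<in> hyper_null \<UU>"
  then have "eventually (\<lambda>i. x i = 0) \<UU>" "eventually (\<lambda>i. y i = 0) \<UU>"
    by (simp_all add: hyper_null_def)
  then have "eventually (\<lambda>i. x i - y i = 0) \<UU>"
    by eventually_elim simp
  then show "x - y \<in> hyper_null \<UU>" by (simp add: hyper_null_def)
qed (simp add: hyper_null_def)

lemma hyper_class_eq_iff: "hyper_class \<UU> x = hyper_class \<UU> y \<longleftrightarrow> eventually (\<lambda>i. x i = y i) \<UU>"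
  using comm_group.rcos_eq_iff[OF comm_group_additive_group subgroup_hyper_null, of x y]
  by (simp add: hyper_class_def hyper_null_def)

lemma mult_hyper_class:
  "hyper_class \<UU> x \<otimes>\<^bsub>hyperreals \<UU>\<^esub> hyper_class \<UU> y = hyper_class \<UU> (x + y)"
  using comm_group.FactGroup_rcos_mult[OF comm_group_additive_group subgroup_hyper_null, of x y]
  by (simp add: hyper_class_def hyperreals_def)

lemma carrier_hyperreals: "carrier (hyperreals \<UU>) = range (hyper_class \<UU>)"
  using comm_group.carrier_FactGroup_image[OF comm_group_additive_group, of "hyper_null \<UU>"]
  by (simp add: hyper_class_def[abs_def] hyperreals_def)

lemma comm_group_hyperreals: "comm_group (hyperreals \<UU>)"
  unfolding hyperreals_def
  by (rule comm_group.abelian_FactGroup[OF comm_group_additive_group subgroup_hyper_null])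

lemma one_hyperreals: "\<one>\<^bsub>hyperreals \<UU>\<^esub> = hyper_class \<UU> 0"
proof -
  interpret comm_group "hyperreals \<UU>" by (rule comm_group_hyperreals)
  have "hyper_class \<UU> 0 \<otimes>\<^bsub>hyperreals \<UU>\<^esub> hyper_class \<UU> 0 = hyper_class \<UU> 0"
    by (simp add: mult_hyper_class)
  then show ?thesis by (metis carrier_hyperreals l_cancel_one rangeI)
qed

lemma inv_hyper_class: "inv\<^bsub>hyperreals \<UU>\<^esub> hyper_class \<UU> x = hyper_class \<UU> (- x)"
proof -
  interpret comm_group "hyperreals \<UU>" by (rule comm_group_hyperreals)
  show ?thesis
    by (rule inv_equality) (auto simp: mult_hyper_class one_hyperreals carrier_hyperreals)
qed

lemma hyper_class_infinitesimal_iff: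
  "hyper_class \<UU> x \<in> infinitesimals \<UU> \<longleftrightarrow> (x \<longlongrightarrow> 0) \<UU>"
proof -
  have eq: "infinitesimals \<UU> = {hyper_class \<UU> x | x. (x \<longlongrightarrow> 0) \<UU>}"
    by (auto simp: infinitesimals_def tendsto_iff)
  have "(x \<longlongrightarrow> 0) \<UU>" if "eventually (\<lambda>i. x i = y i) \<UU>" "(y \<longlongrightarrow> 0) \<UU>" for y
    using tendsto_cong[OF that(1)] that(2) by simp
  moreover have "eventually (\<lambda>i. x i = x i) \<UU>"
    by simp
  ultimately show ?thesis
    unfolding eq mem_Collect_eq hyper_class_eq_iff by blast
qed

lemma subgroup_infinitesimals: "subgroup (infinitesimals \<UU>) (hyperreals \<UU>)"
proof -
  interpret comm_group "hyperreals \<UU>" by (rule comm_group_hyperreals)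
  have eq: "infinitesimals \<UU> = {hyper_class \<UU> x | x. (x \<longlongrightarrow> 0) \<UU>}"
    by (auto simp: infinitesimals_def tendsto_iff)
  have minus: "((- x) \<longlongrightarrow> 0) \<UU>" if "(x \<longlongrightarrow> 0) \<UU>" for x :: "nat \<Rightarrow> real"
    using tendsto_minus[OF that] by (simp add: fun_Compl_def)
  have plus: "((x + y) \<longlongrightarrow> 0) \<UU>" if "(x \<longlongrightarrow> 0) \<UU>" "(y \<longlongrightarrow> 0) \<UU>" for x y :: "nat \<Rightarrow> real"
    using tendsto_add[OF that] by (simp add: plus_fun_def)
  show ?thesis
  proof (rule subgroupI)
    have "((0 :: nat \<Rightarrow> real) \<longlongrightarrow> 0) \<UU>" by (simp add: zero_fun_def)
    then show "infinitesimals \<UU> \<noteq> {}" by (auto simp: eq)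
  next
    show "infinitesimals \<UU> \<subseteq> carrier (hyperreals \<UU>)" by (auto simp: eq carrier_hyperreals)
  next
    fix a assume "a \<in> infinitesimals \<UU>"
    then show "inv\<^bsub>hyperreals \<UU>\<^esub> a \<in> infinitesimals \<UU>"
      using minus by (auto simp: eq inv_hyper_class)
  next
    fix a b assume "a \<in> infinitesimals \<UU>" "b \<in> infinitesimals \<UU>"
    then show "a \<otimes>\<^bsub>hyperreals \<UU>\<^esub> b \<in> infinitesimals \<UU>"
      using plus by (auto simp: eq mult_hyper_class)
  qed
qed

lemma bullet_of_eq_iff:
  "bullet_of \<UU> x = bullet_of \<UU> y \<longleftrightarrow> ((\<lambda>i. x i - y i) \<longlongrightarrow> 0) \<UU>"
proof -
  have "bullet_of \<UU> x = bullet_of \<UU> y \<longleftrightarrow>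
      hyper_class \<UU> x \<otimes>\<^bsub>hyperreals \<UU>\<^esub> inv\<^bsub>hyperreals \<UU>\<^esub> hyper_class \<UU> y \<in> infinitesimals \<UU>"
    using comm_group.rcos_eq_iff[OF comm_group_hyperreals subgroup_infinitesimals]
    by (simp add: bullet_of_def to_bullet_def carrier_hyperreals)
  also have "\<dots> \<longleftrightarrow> ((\<lambda>i. x i - y i) \<longlongrightarrow> 0) \<UU>"
    by (simp add: inv_hyper_class mult_hyper_class hyper_class_infinitesimal_iff plus_fun_def)
  finally show ?thesis .
qed

lemma mult_bullet [simp]:
  "bullet_of \<UU> x \<otimes>\<^bsub>bullet_reals \<UU>\<^esub> bullet_of \<UU> y = bullet_of \<UU> (\<lambda>i. x i + y i)"
  using comm_group.FactGroup_rcos_mult[OF comm_group_hyperreals subgroup_infinitesimals,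
      of "hyper_class \<UU> x" \<UU> "hyper_class \<UU> y"]
  by (simp add: bullet_of_def to_bullet_def bullet_reals_def carrier_hyperreals mult_hyper_class
      plus_fun_def)

lemma carrier_bullet: "carrier (bullet_reals \<UU>) = range (bullet_of \<UU>)"
  using comm_group.carrier_FactGroup_image[OF comm_group_hyperreals, of \<UU> "infinitesimals \<UU>"]
  by (simp add: bullet_reals_def bullet_of_def[abs_def] to_bullet_def carrier_hyperreals image_image)

lemma bullet_of_in_carrier [simp, intro]: "bullet_of \<UU> x \<in> carrier (bullet_reals \<UU>)"
  by (simp add: carrier_bullet)

lemma comm_group_bullet: "comm_group (bullet_reals \<UU>)"
  unfolding bullet_reals_def
  by (rule comm_group.abelian_FactGroup[OF comm_group_hyperreals subgroup_infinitesimals])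

lemma one_bullet: "\<one>\<^bsub>bullet_reals \<UU>\<^esub> = bullet_of \<UU> (\<lambda>i. 0)"
proof -
  interpret comm_group "bullet_reals \<UU>" by (rule comm_group_bullet)
  have "bullet_of \<UU> (\<lambda>i. 0) \<otimes>\<^bsub>bullet_reals \<UU>\<^esub> bullet_of \<UU> (\<lambda>i. 0) = bullet_of \<UU> (\<lambda>i. 0)"
    by simp
  then show ?thesis by (metis l_cancel_one bullet_of_in_carrier)
qed

lemma of_standard_eq: "of_standard \<UU> r = bullet_of \<UU> (\<lambda>i. r)"
  by (simp add: of_standard_def bullet_of_def)

lemma bullet_Z_theta_eq:
  "bullet_Z_theta \<UU> \<theta> = {bullet_of \<UU> n | n. (\<forall>i. n i \<in> \<int>) \<and>
     (\<exists>m. (\<forall>i. m i \<in> \<int>) \<and> ((\<lambda>i. \<theta> * n i - m i) \<longlongrightarrow> 0) \<UU>)}"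
  by (auto simp: bullet_Z_theta_def hyper_Z_theta_def hyper_class_infinitesimal_iff bullet_of_def)

lemma bullet_Z_slope_eq:
  "bullet_Z_slope \<UU> \<theta> q = {bullet_of \<UU> x | x. \<forall>i. x i \<in> Z_slope \<theta> q}"
  by (auto simp: bullet_Z_slope_def ultrapower_def bullet_of_def)

section \<open>The topology of the torus\<close>

lemma topspace_circle [simp]: "topspace circle_topology = range to_circle"
  by (simp add: circle_topology_def topspace_quotient_topology)

lemma topspace_torus [simp]: "topspace torus_topology = carrier torus"
  by (auto simp: torus_topology_def torus_def carrier_circle)

lemma quotient_map_to_circle: "quotient_map euclideanreal circle_topology to_circle"
  unfolding circle_topology_def by (rule quotient_map_quotient_topology)

text \<open>
  Open maps, unlike quotient maps, are stable under products; for this reason the quotient maps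
  that occur as factors of products are shown to be open.
\<close>

lemma open_map_prod:
  assumes "open_map X X' f" "open_map Y Y' g"
  shows "open_map (prod_topology X Y) (prod_topology X' Y') (\<lambda>(x, y). (f x, g y))"
  unfolding open_map_def
proof (intro allI impI)
  fix A assume A: "openin (prod_topology X Y) A"
  show "openin (prod_topology X' Y') ((\<lambda>(x, y). (f x, g y)) ` A)"
    unfolding openin_prod_topology_alt
  proof (intro allI impI)
    fix s t assume "(s, t) \<in> (\<lambda>(x, y). (f x, g y)) ` A"
    then obtain x y where xy: "(x, y) \<in> A" "s = f x" "t = g y" by auto
    obtain U V where UV: "openin X U" "openin Y V" "x \<in> U" "y \<in> V" "U \<times> V \<subseteq> A"
      using A[unfolded openin_prod_topology_alt, rule_format, OF xy(1)] by (elim exE conjE)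
    show "\<exists>U V. openin X' U \<and> openin Y' V \<and> s \<in> U \<and> t \<in> V \<and> U \<times> V \<subseteq> (\<lambda>(x, y). (f x, g y)) ` A"
    proof (intro exI conjI)
      show "openin X' (f ` U)" "openin Y' (g ` V)"
        using assms UV by (auto simp: open_map_def)
      show "f ` U \<times> g ` V \<subseteq> (\<lambda>(x, y). (f x, g y)) ` A"
        using UV(5) by force
    qed (use xy UV in auto)
  qed
qed

lemma homeomorphic_map_prod:
  assumes "homeomorphic_map X X' f" "homeomorphic_map Y Y' g"
  shows "homeomorphic_map (prod_topology X Y) (prod_topology X' Y') (\<lambda>(x, y). (f x, g y))"
proof (rule bijective_open_imp_homeomorphic_map)
  show "continuous_map (prod_topology X Y) (prod_topology X' Y') (\<lambda>(x, y). (f x, g y))"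
    unfolding continuous_map_prod_top
    using assms by (intro disjI2 conjI) (simp_all add: homeomorphic_imp_continuous_map)
  show "open_map (prod_topology X Y) (prod_topology X' Y') (\<lambda>(x, y). (f x, g y))"
    using assms by (intro open_map_prod) (simp_all add: homeomorphic_imp_open_map)
  show "(\<lambda>(x, y). (f x, g y)) ` topspace (prod_topology X Y) = topspace (prod_topology X' Y')"
    using assms by (simp only: topspace_prod_topology image_paired_Times homeomorphic_imp_surjective_map)
  show "inj_on (\<lambda>(x, y). (f x, g y)) (topspace (prod_topology X Y))"
    using assms[THEN homeomorphic_imp_injective_map] by (auto simp: inj_on_def)
qed

text \<open>
  The saturation of an open set is the union of its integer translates.
\<close>

lemma open_map_to_circle: "open_map euclideanreal circle_topology to_circle"
  unfolding open_map_def
proof (intro allI impI)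
  fix U :: "real set" assume U: "openin euclideanreal U"
  have "{x. to_circle x \<in> to_circle ` U} = (\<Union>k\<in>\<int>. (\<lambda>x. k + x) ` U)"
  proof (intro equalityI subsetI)
    fix x assume "x \<in> {x. to_circle x \<in> to_circle ` U}"
    then obtain u where u: "u \<in> U" "x - u \<in> \<int>" by (auto simp: to_circle_eq_iff)
    then show "x \<in> (\<Union>k\<in>\<int>. (\<lambda>x. k + x) ` U)"
      by (intro UN_I[of "x - u"] image_eqI[of _ _ u]) auto
  next
    fix x assume "x \<in> (\<Union>k\<in>\<int>. (\<lambda>x. k + x) ` U)"
    then obtain k u where u: "k \<in> \<int>" "u \<in> U" "x = k + u" by blast
    then have "to_circle x = to_circle u" by (simp add: to_circle_eq_iff)
    with u(2) show "x \<in> {x. to_circle x \<in> to_circle ` U}" by blast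
  qed
  moreover have "open (\<Union>k\<in>\<int>. (\<lambda>x. k + x) ` U)"
    using U by (auto intro!: open_UN open_translation)
  ultimately show "openin circle_topology (to_circle ` U)"
    by (auto simp: circle_topology_def openin_quotient_topology)
qed

definition torus_cover :: "real \<times> real \<Rightarrow> real set \<times> real set" where
  "torus_cover = (\<lambda>(x, y). to_torus x y)"

lemma torus_cover_simp [simp]: "torus_cover (x, y) = to_torus x y"
  by (simp add: torus_cover_def)

lemma continuous_map_torus_cover: "continuous_map euclidean torus_topology torus_cover"
proof -
  have c: "continuous_map euclideanreal circle_topology to_circle"
    by (rule quotient_imp_continuous_map[OF quotient_map_to_circle])
  have "continuous_map (prod_topology euclideanreal euclideanreal) torus_topology
      (\<lambda>(x, y). (to_circle x, to_circle y))"
    unfolding torus_topology_def continuous_map_prod_top using c by (intro disjI2 conjI)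
  then show ?thesis by (simp add: torus_cover_def to_torus_def)
qed

lemma open_map_torus_cover: "open_map euclidean torus_topology torus_cover"
proof -
  have "open_map (prod_topology euclideanreal euclideanreal) torus_topology
      (\<lambda>(x, y). (to_circle x, to_circle y))"
    unfolding torus_topology_def by (rule open_map_prod[OF open_map_to_circle open_map_to_circle])
  then show ?thesis by (simp add: torus_cover_def to_torus_def)
qed

lemma range_torus_cover: "range torus_cover = carrier torus"
  unfolding carrier_torus torus_cover_def by force

text \<open>
  Two distinct points have lifts whose difference keeps a positive distance from the closed set
  of integers; small balls around the lifts then have disjoint images.
\<close>

lemma Hausdorff_circle: "Hausdorff_space circle_topology"
  unfolding Hausdorff_space_def
proof (intro allI impI, elim conjE)
  fix s t assume "s \<in> topspace circle_topology" "t \<in> topspace circle_topology" "s \<noteq> t"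
  then obtain x y where xy: "s = to_circle x" "t = to_circle y" "x - y \<notin> \<int>"
    unfolding topspace_circle by (metis to_circle_eq_iff rangeE)
  have "open (- \<int> :: real set)" by (simp add: closed_Ints open_Compl)
  with xy(3) obtain e where e: "e > 0" "ball (x - y) e \<subseteq> - \<int>"
    by (metis ComplI open_contains_ball)
  let ?U = "to_circle ` ball x (e/2)" and ?V = "to_circle ` ball y (e/2)"
  have "disjnt ?U ?V"
  proof -
    have False if "a \<in> ball x (e/2)" "b \<in> ball y (e/2)" "a - b \<in> \<int>" for a b
    proof -
      have "a - b \<in> ball (x - y) e"
        using that(1,2) unfolding mem_ball dist_real_def by linarith
      with e that(3) show False by blast
    qed
    then show ?thesis unfolding disjnt_def by (auto simp: to_circle_eq_iff)
  qed
  moreover have "openin circle_topology ?U" "openin circle_topology ?V"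
    using open_map_to_circle by (auto simp: open_map_def)
  moreover have "s \<in> ?U" "t \<in> ?V" using e xy by auto
  ultimately show "\<exists>U V. openin circle_topology U \<and> openin circle_topology V \<and> s \<in> U \<and> t \<in> V \<and> disjnt U V"
    by blast
qed

lemma Hausdorff_torus: "Hausdorff_space torus_topology"
  by (simp add: torus_topology_def Hausdorff_space_prod_topology Hausdorff_circle)

text \<open>
  Addition is continuous because it is covered by the addition of \<open>\<real>\<^sup>2\<close>, and a
  product of open surjections is again a quotient map.
\<close>

lemma continuous_map_torus_add:
  "continuous_map (prod_topology torus_topology torus_topology) torus_topology
     (\<lambda>(s, t). s \<otimes>\<^bsub>torus\<^esub> t)"
proof -
  let ?E = "prod_topology (euclidean :: (real \<times> real) topology) (euclidean :: (real \<times> real) topology)"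
  let ?c = "\<lambda>(x, y). (torus_cover x, torus_cover y)"
  have "continuous_map ?E (prod_topology torus_topology torus_topology) ?c"
    unfolding continuous_map_prod_top using continuous_map_torus_cover by (intro disjI2 conjI)
  moreover have "open_map ?E (prod_topology torus_topology torus_topology) ?c"
    by (rule open_map_prod[OF open_map_torus_cover open_map_torus_cover])
  ultimately have "quotient_map ?E (prod_topology torus_topology torus_topology) ?c"
    by (rule continuous_open_imp_quotient_map) (simp only: topspace_prod_topology topspace_euclidean image_paired_Times range_torus_cover
        topspace_torus)
  moreover have "continuous_map ?E torus_topology ((\<lambda>(s, t). s \<otimes>\<^bsub>torus\<^esub> t) \<circ> ?c)"
  proof (rule continuous_map_eq)
    show "continuous_map ?E torus_topology (torus_cover \<circ> (\<lambda>(x, y). x + y))"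
      by (rule continuous_map_compose[OF _ continuous_map_torus_cover])
        (auto simp: case_prod_unfold intro!: continuous_intros)
  qed (auto simp: torus_cover_def case_prod_unfold)
  ultimately show ?thesis
    by (rule continuous_compose_quotient_map)
qed


section \<open>Rational slopes\<close>

text \<open>
  The vector \<open>(run q, rise q)\<close> spans the line of slope \<open>q\<close>; in terms of it the
  infinite slope is no special case.
\<close>

fun run :: "slope \<Rightarrow> real" where
  "run (Slope q) = 1"
| "run Infinite_Slope = 0"

fun rise :: "slope \<Rightarrow> real" where
  "rise (Slope q) = of_rat q"
| "rise Infinite_Slope = 1"

lemma torus_line_eq: "torus_line q = {to_torus (w * run q) (w * rise q) | w. True}"
  by (cases q) (auto simp: mult.commute)

text \<open>
  The values at the integer points of a linear form that vanishes on the line of slope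
  \<open>q\<close>.  Membership in this subgroup of the reals describes both the image of the line in
  the torus and, after division by a determinant, \<open>\<int>\<^sub>q\<close>.
\<close>

definition slope_lattice :: "slope \<Rightarrow> real set" where
  "slope_lattice q = {run q * b - rise q * a | a b. a \<in> \<int> \<and> b \<in> \<int>}"

lemma slope_latticeI: "a \<in> \<int> \<Longrightarrow> b \<in> \<int> \<Longrightarrow> run q * b - rise q * a \<in> slope_lattice q"
  by (auto simp: slope_lattice_def)

lemma slope_latticeE:
  assumes "l \<in> slope_lattice q"
  obtains a b where "a \<in> \<int>" "b \<in> \<int>" "l = run q * b - rise q * a"
  using assms by (auto simp: slope_lattice_def)

lemma slope_lattice_add:
  assumes "k \<in> slope_lattice q" "l \<in> slope_lattice q"
  shows "k + l \<in> slope_lattice q"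
proof -
  from assms(1) obtain a b where 1: "a \<in> \<int>" "b \<in> \<int>" "k = run q * b - rise q * a"
    by (rule slope_latticeE)
  from assms(2) obtain c d where 2: "c \<in> \<int>" "d \<in> \<int>" "l = run q * d - rise q * c"
    by (rule slope_latticeE)
  have "k + l = run q * (b + d) - rise q * (a + c)" by (simp add: 1 2 algebra_simps)
  then show ?thesis using 1 2 by (simp add: slope_latticeI)
qed

lemma slope_lattice_minus:
  assumes "k \<in> slope_lattice q" shows "- k \<in> slope_lattice q"
proof -
  from assms obtain a b where 1: "a \<in> \<int>" "b \<in> \<int>" "k = run q * b - rise q * a"
    by (rule slope_latticeE)
  have "- k = run q * (- b) - rise q * (- a)" by (simp add: 1)
  then show ?thesis using 1 by (simp only: slope_latticeI Ints_minus)
qed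

lemma slope_lattice_diff:
  "k \<in> slope_lattice q \<Longrightarrow> l \<in> slope_lattice q \<Longrightarrow> k - l \<in> slope_lattice q"
  using slope_lattice_add[OF _ slope_lattice_minus] by fastforce

lemma to_torus_in_line_iff:
  "to_torus x y \<in> torus_line q \<longleftrightarrow> run q * y - rise q * x \<in> slope_lattice q"
proof
  assume "to_torus x y \<in> torus_line q"
  then obtain w where w: "x - w * run q \<in> \<int>" "y - w * rise q \<in> \<int>"
    by (auto simp: torus_line_eq to_torus_eq_iff)
  have "run q * y - rise q * x = run q * (y - w * rise q) - rise q * (x - w * run q)"
    by (simp add: algebra_simps)
  with w show "run q * y - rise q * x \<in> slope_lattice q" by (simp only: slope_latticeI)
next
  assume "run q * y - rise q * x \<in> slope_lattice q"
  then obtain a b where ab: "a \<in> \<int>" "b \<in> \<int>" "run q * y - rise q * x = run q * b - rise q * a"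
    by (rule slope_latticeE)
  \<comment> \<open>the parameter on the line is read off from a coordinate in which the line is not constant\<close>
  let ?w = "if run q = 0 then y - b else x - a"
  have "x - ?w * run q = a \<and> y - ?w * rise q = b"
    using ab(3) by (cases q) (simp_all add: algebra_simps)
  then have "to_torus x y = to_torus (?w * run q) (?w * rise q)"
    using ab by (simp add: to_torus_eq_iff)
  then show "to_torus x y \<in> torus_line q" by (auto simp: torus_line_eq)
qed

text \<open>
  For slope \<open>a/b\<close> the lattice lies in \<open>\<int>/b\<close>, so that distinct points of it
  are uniformly separated.
\<close>

lemma slope_lattice_uniformly_discrete:
  obtains c where "c > 0" "\<And>k l. k \<in> slope_lattice q \<Longrightarrow> l \<in> slope_lattice q \<Longrightarrow> \<bar>k - l\<bar> < c \<Longrightarrow> k = l"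
proof -
  obtain d :: real where d: "d > 0" "d * run q \<in> \<int>" "d * rise q \<in> \<int>"
  proof (cases q)
    case (Slope r)
    obtain a b :: int where ab: "b > 0" "r = Fract a b"
      by (cases r) auto
    then have "real_of_int b * rise q = of_int a" "real_of_int b * run q = of_int b"
      using Slope by (simp_all add: of_rat_rat)
    with ab(1) show ?thesis by (intro that[of "of_int b"]) simp_all
  qed (use that[of 1] in simp)
  have int: "d * k \<in> \<int>" if "k \<in> slope_lattice q" for k
  proof -
    from that obtain a b where ab: "a \<in> \<int>" "b \<in> \<int>" "k = run q * b - rise q * a"
      by (rule slope_latticeE)
    have "d * k = (d * run q) * b - (d * rise q) * a" by (simp add: ab algebra_simps)
    then show ?thesis using d ab by simp
  qed
  show ?thesis
  proof (rule that[of "1 / d"])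
    fix k l assume kl: "k \<in> slope_lattice q" "l \<in> slope_lattice q" "\<bar>k - l\<bar> < 1 / d"
    have "d * (k - l) \<in> \<int>" by (rule int[OF slope_lattice_diff[OF kl(1,2)]])
    moreover have "\<bar>d * (k - l)\<bar> < 1"
      using kl(3) d(1) by (simp only: abs_mult abs_of_pos pos_less_divide_eq mult.commute)
    ultimately have "d * (k - l) = 0" by (rule Ints_nonzero_abs_less1)
    then show "k = l" using d by simp
  qed (use d in simp)
qed

lemma closed_slope_lattice: "closed (slope_lattice q)"
proof -
  obtain c where c: "c > 0"
    "\<And>k l. k \<in> slope_lattice q \<Longrightarrow> l \<in> slope_lattice q \<Longrightarrow> \<bar>k - l\<bar> < c \<Longrightarrow> k = l"
    using slope_lattice_uniformly_discrete[of q] by metis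
  show ?thesis
    by (rule discrete_imp_closed[OF c(1)]) (simp add: dist_real_def c(2))
qed

text \<open>The determinant of the directions of the leaves and of the transversal.\<close>

definition slope_det :: "real \<Rightarrow> slope \<Rightarrow> real" where
  "slope_det \<theta> q = run q * \<theta> - rise q"

lemma slope_det_nonzero: "\<theta> \<notin> \<rat> \<Longrightarrow> slope_det \<theta> q \<noteq> 0"
  by (cases q) (auto simp: slope_det_def)

text \<open>
  A multiple \<open>r\<close> of \<open>(1, \<theta>)\<close> has the value \<open>r * slope_det \<theta> q\<close> under
  the linear form of the line.
\<close>

lemma Z_slope_iff: "r \<in> Z_slope \<theta> q \<longleftrightarrow> r * slope_det \<theta> q \<in> slope_lattice q"
proof -
  have "r * slope_det \<theta> q = run q * (r * \<theta>) - rise q * r"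
    by (simp add: slope_det_def algebra_simps)
  then show ?thesis by (simp add: Z_slope_def to_torus_in_line_iff)
qed

lemma torus_line_subset: "torus_line q \<subseteq> carrier torus"
  by (auto simp: torus_line_eq)

text \<open>
  Since \<open>\<theta>\<close> is irrational, the lines of slopes \<open>\<theta>\<close> and \<open>q\<close>
  are transverse, so they give linear coordinates on the plane.
\<close>

definition line_coordinates :: "real \<Rightarrow> slope \<Rightarrow> real \<times> real \<Rightarrow> real \<times> real" where
  "line_coordinates \<theta> q = (\<lambda>(r, w). (r + w * run q, r * \<theta> + w * rise q))"

lemma homeomorphic_map_line_coordinates:
  assumes "\<theta> \<notin> \<rat>"
  shows "homeomorphic_map euclidean euclidean (line_coordinates \<theta> q)"
proof -
  \<comment> \<open>Cramer's rule\<close>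
  let ?inv = "\<lambda>(x, y). ((run q * y - rise q * x) / slope_det \<theta> q, (\<theta> * x - y) / slope_det \<theta> q)"
  have d: "slope_det \<theta> q \<noteq> 0" by (rule slope_det_nonzero[OF assms])
  have 1: "?inv (line_coordinates \<theta> q p) = p" for p
  proof (cases p)
    case (Pair r w)
    have "run q * (r * \<theta> + w * rise q) - rise q * (r + w * run q) = r * slope_det \<theta> q"
      "\<theta> * (r + w * run q) - (r * \<theta> + w * rise q) = w * slope_det \<theta> q"
      by (simp_all add: slope_det_def algebra_simps)
    with d show ?thesis by (simp add: Pair line_coordinates_def)
  qed
  have 2: "line_coordinates \<theta> q (?inv p) = p" for p
  proof (cases p)
    case (Pair x y)
    have "(run q * y - rise q * x) + (\<theta> * x - y) * run q = x * slope_det \<theta> q"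
      "(run q * y - rise q * x) * \<theta> + (\<theta> * x - y) * rise q = y * slope_det \<theta> q"
      by (simp_all add: slope_det_def algebra_simps)
    with d show ?thesis
      by (simp add: Pair line_coordinates_def add_divide_distrib[symmetric])
  qed
  have c: "continuous_on UNIV (line_coordinates \<theta> q)" "continuous_on UNIV ?inv"
    using d by (auto simp: line_coordinates_def case_prod_unfold intro!: continuous_intros)
  have "homeomorphic_maps euclidean euclidean (line_coordinates \<theta> q) ?inv"
    unfolding homeomorphic_maps_def using 1 2 c by (simp del: split_paired_All)
  then show ?thesis by (rule homeomorphic_maps_imp_map)
qed

section \<open>The limit homomorphism from the bullet reals to the torus\<close>

text \<open>
  This is \<open>limit_map\<close> without the restriction to sequences in \<open>\<int>\<^sub>q\<close>, so
  that it is defined on all of the bullet reals.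
\<close>

definition line_limit :: "nat filter \<Rightarrow> real \<Rightarrow> bullet \<Rightarrow> real set \<times> real set" where
  "line_limit \<UU> \<theta> x =
     (THE t. \<exists>y. x = bullet_of \<UU> y \<and> limitin torus_topology (\<lambda>i. to_torus (y i) (y i * \<theta>)) t \<UU>)"

text \<open>
  A lift to the plane of the convergence of \<open>(x i, x i * \<theta>)\<close> to the class of
  \<open>(a, b)\<close> in the torus.  Limits of real sequences are easier to add and to compare with
  integers than limits in the torus.
\<close>

definition approaches :: "nat filter \<Rightarrow> real \<Rightarrow> (nat \<Rightarrow> real) \<Rightarrow> real \<Rightarrow> real \<Rightarrow> bool" where
  "approaches \<UU> \<theta> x a b \<longleftrightarrow> (\<exists>n m. (\<forall>i. n i \<in> \<int>) \<and> (\<forall>i. m i \<in> \<int>) \<and>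
     ((\<lambda>i. x i - n i) \<longlongrightarrow> a) \<UU> \<and> ((\<lambda>i. x i * \<theta> - m i) \<longlongrightarrow> b) \<UU>)"

lemma approachesI:
  assumes "\<And>i. n i \<in> \<int>" "\<And>i. m i \<in> \<int>"
    "((\<lambda>i. x i - n i) \<longlongrightarrow> a) \<UU>" "((\<lambda>i. x i * \<theta> - m i) \<longlongrightarrow> b) \<UU>"
  shows "approaches \<UU> \<theta> x a b"
  using assms by (auto simp: approaches_def)

lemma approachesE:
  assumes "approaches \<UU> \<theta> x a b"
  obtains n m where "\<forall>i. n i \<in> \<int>" "\<forall>i. m i \<in> \<int>"
    "((\<lambda>i. x i - n i) \<longlongrightarrow> a) \<UU>" "((\<lambda>i. x i * \<theta> - m i) \<longlongrightarrow> b) \<UU>"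
  using assms by (auto simp: approaches_def)

lemma approaches_imp_limitin:
  assumes "approaches \<UU> \<theta> x a b"
  shows "limitin torus_topology (\<lambda>i. to_torus (x i) (x i * \<theta>)) (to_torus a b) \<UU>"
proof -
  from assms obtain n m where nm: "\<forall>i. n i \<in> \<int>" "\<forall>i. m i \<in> \<int>"
    "((\<lambda>i. x i - n i) \<longlongrightarrow> a) \<UU>" "((\<lambda>i. x i * \<theta> - m i) \<longlongrightarrow> b) \<UU>"
    by (rule approachesE)
  have "limitin euclidean (\<lambda>i. (x i - n i, x i * \<theta> - m i)) (a, b) \<UU>"
    using nm by (simp add: tendsto_Pair)
  from continuous_map_limit[OF continuous_map_torus_cover this]
  have "limitin torus_topology (\<lambda>i. to_torus (x i - n i) (x i * \<theta> - m i)) (to_torus a b) \<UU>"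
    by (simp add: comp_def)
  moreover have "to_torus (x i - n i) (x i * \<theta> - m i) = to_torus (x i) (x i * \<theta>)" for i
    using nm by (simp add: to_torus_eq_iff)
  ultimately show ?thesis by simp
qed

lemma approaches_add:
  assumes "approaches \<UU> \<theta> x a b" "approaches \<UU> \<theta> y c d"
  shows "approaches \<UU> \<theta> (\<lambda>i. x i + y i) (a + c) (b + d)"
proof -
  from assms(1) obtain n m where 1: "\<forall>i. n i \<in> \<int>" "\<forall>i. m i \<in> \<int>"
    "((\<lambda>i. x i - n i) \<longlongrightarrow> a) \<UU>" "((\<lambda>i. x i * \<theta> - m i) \<longlongrightarrow> b) \<UU>"
    by (rule approachesE)
  from assms(2) obtain n' m' where 2: "\<forall>i. n' i \<in> \<int>" "\<forall>i. m' i \<in> \<int>"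
    "((\<lambda>i. y i - n' i) \<longlongrightarrow> c) \<UU>" "((\<lambda>i. y i * \<theta> - m' i) \<longlongrightarrow> d) \<UU>"
    by (rule approachesE)
  show ?thesis
    using tendsto_add[OF 1(3) 2(3)] tendsto_add[OF 1(4) 2(4)] 1 2
    by (intro approachesI[of "\<lambda>i. n i + n' i" "\<lambda>i. m i + m' i"]) (simp_all add: algebra_simps)
qed

lemma approaches_infinitesimal:
  assumes "(e \<longlongrightarrow> 0) \<UU>" shows "approaches \<UU> \<theta> e 0 0"
  using assms tendsto_mult_left_zero[OF assms, of \<theta>]
  by (intro approachesI[of "\<lambda>i. 0" "\<lambda>i. 0"]) simp_all

lemma approaches_const: "approaches \<UU> \<theta> (\<lambda>i. r) r (r * \<theta>)"
  by (intro approachesI[of "\<lambda>i. 0" "\<lambda>i. 0"]) simp_all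

lemma approaches_bullet_cong:
  assumes "bullet_of \<UU> x = bullet_of \<UU> y" "approaches \<UU> \<theta> x a b"
  shows "approaches \<UU> \<theta> y a b"
proof -
  have "((\<lambda>i. y i - x i) \<longlongrightarrow> 0) \<UU>"
    using assms(1)[symmetric] by (simp add: bullet_of_eq_iff)
  from approaches_add[OF assms(2) approaches_infinitesimal[OF this]] show ?thesis by simp
qed


locale irrational_line =
  fixes \<UU> :: "nat filter" and \<theta> :: real
  assumes ultrafilter: "nonprincipal_ultrafilter \<UU>" and irrational: "\<theta> \<notin> \<rat>"
begin

lemma ultrafilter_nontrivial: "\<UU> \<noteq> bot"
  using ultrafilter by (simp add: nonprincipal_ultrafilter_def)

text \<open>
  The fractional parts lie in a compact interval, where the ultrafilter forces them to converge.
\<close>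

lemma approaches_exists:
  obtains a b where "approaches \<UU> \<theta> x a b"
proof -
  have f: "frac r \<in> {0..1::real}" for r :: real
    using frac_lt_1[of r] by simp
  obtain a where a: "((\<lambda>i. frac (x i)) \<longlongrightarrow> a) \<UU>"
    by (rule ultrafilter_tendsto_compact[OF ultrafilter compact_Icc f])
  obtain b where b: "((\<lambda>i. frac (x i * \<theta>)) \<longlongrightarrow> b) \<UU>"
    by (rule ultrafilter_tendsto_compact[OF ultrafilter compact_Icc f])
  have "approaches \<UU> \<theta> x a b"
    using a b
    by (intro approachesI[of "\<lambda>i. of_int \<lfloor>x i\<rfloor>" "\<lambda>i. of_int \<lfloor>x i * \<theta>\<rfloor>"]) (simp_all add: frac_def)
  then show ?thesis by (rule that)
qed

text \<open>
  Changing the representative by an infinitesimal sequence does not change the limit in the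
  torus, and limits in the Hausdorff torus are unique: \<open>line_limit\<close> is well defined.
\<close>

lemma approaches_limit_unique:
  assumes "approaches \<UU> \<theta> x a b" "bullet_of \<UU> x = bullet_of \<UU> y"
    "limitin torus_topology (\<lambda>i. to_torus (y i) (y i * \<theta>)) t \<UU>"
  shows "t = to_torus a b"
  using limitin_Hausdorff_unique[OF assms(3) _ ultrafilter_nontrivial Hausdorff_torus]
    approaches_imp_limitin[OF approaches_bullet_cong[OF assms(2,1)]] by blast

lemma line_limit_eq:
  assumes "approaches \<UU> \<theta> x a b"
  shows "line_limit \<UU> \<theta> (bullet_of \<UU> x) = to_torus a b"
  unfolding line_limit_def
proof (rule the_equality)
  show "\<exists>y. bullet_of \<UU> x = bullet_of \<UU> y \<and>
      limitin torus_topology (\<lambda>i. to_torus (y i) (y i * \<theta>)) (to_torus a b) \<UU>"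
    using approaches_imp_limitin[OF assms] by blast
qed (use approaches_limit_unique[OF assms] in blast)

lemma bullet_cases:
  assumes "x \<in> carrier (bullet_reals \<UU>)"
  obtains y a b where "x = bullet_of \<UU> y" "approaches \<UU> \<theta> y a b" "line_limit \<UU> \<theta> x = to_torus a b"
  using assms approaches_exists line_limit_eq unfolding carrier_bullet by (metis rangeE)

lemma line_limit_carrier:
  "x \<in> carrier (bullet_reals \<UU>) \<Longrightarrow> line_limit \<UU> \<theta> x \<in> carrier torus"
  by (erule bullet_cases) simp

lemma line_limit_mult:
  assumes "x \<in> carrier (bullet_reals \<UU>)" "y \<in> carrier (bullet_reals \<UU>)"
  shows "line_limit \<UU> \<theta> (x \<otimes>\<^bsub>bullet_reals \<UU>\<^esub> y) = line_limit \<UU> \<theta> x \<otimes>\<^bsub>torus\<^esub> line_limit \<UU> \<theta> y"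
proof -
  from assms(1) obtain v a b where x: "x = bullet_of \<UU> v" "approaches \<UU> \<theta> v a b"
    "line_limit \<UU> \<theta> x = to_torus a b" by (rule bullet_cases)
  from assms(2) obtain w c d where y: "y = bullet_of \<UU> w" "approaches \<UU> \<theta> w c d"
    "line_limit \<UU> \<theta> y = to_torus c d" by (rule bullet_cases)
  show ?thesis
    using line_limit_eq[OF approaches_add[OF x(2) y(2)]] by (simp add: x(3) y(3)) (simp add: x(1) y(1))
qed

lemma line_limit_of_standard: "line_limit \<UU> \<theta> (of_standard \<UU> r) = to_torus r (r * \<theta>)"
  unfolding of_standard_eq by (rule line_limit_eq[OF approaches_const])

lemma line_limit_kernel:
  assumes "x \<in> carrier (bullet_reals \<UU>)"
  shows "line_limit \<UU> \<theta> x = \<one>\<^bsub>torus\<^esub> \<longleftrightarrow> x \<in> bullet_Z_theta \<UU> \<theta>"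
proof
  from assms obtain y a b where y: "x = bullet_of \<UU> y" "approaches \<UU> \<theta> y a b"
    "line_limit \<UU> \<theta> x = to_torus a b" by (rule bullet_cases)
  from y(2) obtain n m where nm: "\<forall>i. n i \<in> \<int>" "\<forall>i. m i \<in> \<int>"
    "((\<lambda>i. y i - n i) \<longlongrightarrow> a) \<UU>" "((\<lambda>i. y i * \<theta> - m i) \<longlongrightarrow> b) \<UU>"
    by (rule approachesE)
  assume "line_limit \<UU> \<theta> x = \<one>\<^bsub>torus\<^esub>"
  then have ab: "a \<in> \<int>" "b \<in> \<int>" by (simp_all add: y(3) one_torus to_torus_eq_iff)
  have n: "((\<lambda>i. y i - (n i + a)) \<longlongrightarrow> 0) \<UU>"
    using tendsto_diff[OF nm(3) tendsto_const[of a]] by (simp add: algebra_simps)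
  have "((\<lambda>i. (y i * \<theta> - m i) - b - \<theta> * (y i - (n i + a))) \<longlongrightarrow> b - b - \<theta> * 0) \<UU>"
    by (intro tendsto_intros nm n)
  then have "((\<lambda>i. \<theta> * (n i + a) - (m i + b)) \<longlongrightarrow> 0) \<UU>"
    by (simp add: algebra_simps)
  moreover have "x = bullet_of \<UU> (\<lambda>i. n i + a)"
    using n by (simp add: y(1) bullet_of_eq_iff)
  moreover have "\<forall>i. n i + a \<in> \<int>" "\<forall>i. m i + b \<in> \<int>" using nm ab by simp_all
  ultimately show "x \<in> bullet_Z_theta \<UU> \<theta>"
    unfolding bullet_Z_theta_eq mem_Collect_eq by (intro exI[of _ "\<lambda>i. n i + a"] conjI exI[of _ "\<lambda>i. m i + b"])
next
  assume "x \<in> bullet_Z_theta \<UU> \<theta>"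
  then obtain n m where nm: "x = bullet_of \<UU> n" "\<forall>i. n i \<in> \<int>" "\<forall>i. m i \<in> \<int>"
    "((\<lambda>i. \<theta> * n i - m i) \<longlongrightarrow> 0) \<UU>"
    unfolding bullet_Z_theta_eq by blast
  then have "approaches \<UU> \<theta> n 0 0"
    by (intro approachesI[of n m]) (simp_all add: mult.commute)
  from line_limit_eq[OF this] show "line_limit \<UU> \<theta> x = \<one>\<^bsub>torus\<^esub>"
    by (simp add: nm(1) one_torus)
qed

text \<open>
  The linear form of the line of slope \<open>q\<close>, applied to \<open>(y i, y i * \<theta>)\<close>, equals
  up to an element of the lattice a sequence that converges to its value at \<open>(a, b)\<close>.  For
  \<open>y i\<close> in \<open>\<int>\<^sub>q\<close> all these values lie in the lattice, which is closed, so the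
  limit lies on the line.  Conversely, if the limiting value is in the lattice, replacing the
  value at \<open>i\<close> by the limiting one moves \<open>y\<close> by an infinitesimal into
  \<open>\<int>\<^sub>q\<close>.
\<close>

lemma bullet_Z_slope_iff:
  "x \<in> bullet_Z_slope \<UU> \<theta> q \<longleftrightarrow> x \<in> carrier (bullet_reals \<UU>) \<and> line_limit \<UU> \<theta> x \<in> torus_line q"
proof (intro iffI conjI; (elim conjE)?)
  assume "x \<in> bullet_Z_slope \<UU> \<theta> q"
  then obtain y where y: "x = bullet_of \<UU> y" "\<And>i. y i \<in> Z_slope \<theta> q"
    unfolding bullet_Z_slope_eq by blast
  then show "x \<in> carrier (bullet_reals \<UU>)" by simp
  obtain a b where ab: "approaches \<UU> \<theta> y a b" by (rule approaches_exists)
  then obtain n m where nm: "\<forall>i. n i \<in> \<int>" "\<forall>i. m i \<in> \<int>"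
    "((\<lambda>i. y i - n i) \<longlongrightarrow> a) \<UU>" "((\<lambda>i. y i * \<theta> - m i) \<longlongrightarrow> b) \<UU>"
    by (rule approachesE)
  have lim: "((\<lambda>i. run q * (y i * \<theta> - m i) - rise q * (y i - n i)) \<longlongrightarrow> run q * b - rise q * a) \<UU>"
    by (intro tendsto_intros nm)
  have mem: "run q * (y i * \<theta> - m i) - rise q * (y i - n i) \<in> slope_lattice q" for i
  proof -
    have "run q * (y i * \<theta> - m i) - rise q * (y i - n i)
        = y i * slope_det \<theta> q - (run q * m i - rise q * n i)"
      by (simp add: slope_det_def algebra_simps)
    also have "\<dots> \<in> slope_lattice q"
      using y(2)[of i] nm(1,2) by (intro slope_lattice_diff slope_latticeI) (simp_all add: Z_slope_iff)
    finally show ?thesis .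
  qed
  have "run q * b - rise q * a \<in> slope_lattice q"
    by (rule Lim_in_closed_set[OF closed_slope_lattice _ ultrafilter_nontrivial lim])
      (intro always_eventually allI mem)
  then show "line_limit \<UU> \<theta> x \<in> torus_line q"
    by (simp add: y(1) line_limit_eq[OF ab] to_torus_in_line_iff)
next
  assume "x \<in> carrier (bullet_reals \<UU>)"
  then obtain y a b where y: "x = bullet_of \<UU> y" "approaches \<UU> \<theta> y a b"
    "line_limit \<UU> \<theta> x = to_torus a b" by (rule bullet_cases)
  from y(2) obtain n m where nm: "\<forall>i. n i \<in> \<int>" "\<forall>i. m i \<in> \<int>"
    "((\<lambda>i. y i - n i) \<longlongrightarrow> a) \<UU>" "((\<lambda>i. y i * \<theta> - m i) \<longlongrightarrow> b) \<UU>"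
    by (rule approachesE)
  assume "line_limit \<UU> \<theta> x \<in> torus_line q"
  then have l: "run q * b - rise q * a \<in> slope_lattice q"
    by (simp add: y(3) to_torus_in_line_iff)
  have d: "slope_det \<theta> q \<noteq> 0" by (rule slope_det_nonzero[OF irrational])
  \<comment> \<open>the sequence \<open>?r\<close> in \<open>\<int>\<^sub>q\<close> has exactly these values under the linear form\<close>
  let ?l = "\<lambda>i. run q * b - rise q * a + (run q * m i - rise q * n i)"
  let ?r = "\<lambda>i. ?l i / slope_det \<theta> q"
  have r: "?r i \<in> Z_slope \<theta> q" for i
    using l nm(1,2) d by (simp add: Z_slope_iff slope_lattice_add slope_latticeI)
  have "((\<lambda>i. (run q * (y i * \<theta> - m i) - rise q * (y i - n i) - (run q * b - rise q * a)) / slope_det \<theta> q)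
      \<longlongrightarrow> (run q * b - rise q * a - (run q * b - rise q * a)) / slope_det \<theta> q) \<UU>"
    by (intro tendsto_intros nm d)
  moreover have "(run q * (y i * \<theta> - m i) - rise q * (y i - n i) - (run q * b - rise q * a)) / slope_det \<theta> q
      = y i - ?r i" for i
  proof -
    have "run q * (y i * \<theta> - m i) - rise q * (y i - n i) - (run q * b - rise q * a)
        = y i * slope_det \<theta> q - ?l i"
      by (simp add: slope_det_def algebra_simps)
    then show ?thesis
      by (simp only: diff_divide_distrib[of "y i * slope_det \<theta> q"] nonzero_mult_div_cancel_right[OF d])
  qed
  ultimately have "((\<lambda>i. y i - ?r i) \<longlongrightarrow> 0) \<UU>" by simp
  then have "x = bullet_of \<UU> ?r" by (simp add: y(1) bullet_of_eq_iff)
  with r show "x \<in> bullet_Z_slope \<UU> \<theta> q" unfolding bullet_Z_slope_eq by blast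
qed

lemma limit_map_eq_line_limit:
  assumes "m \<in> bullet_Z_slope \<UU> \<theta> q"
  shows "limit_map \<UU> \<theta> q m = line_limit \<UU> \<theta> m"
proof -
  from assms obtain y where y: "m = bullet_of \<UU> y" "\<forall>i. y i \<in> Z_slope \<theta> q"
    unfolding bullet_Z_slope_eq by blast
  obtain a b where ab: "approaches \<UU> \<theta> y a b" by (rule approaches_exists)
  show ?thesis
    unfolding limit_map_def y(1) line_limit_eq[OF ab] bullet_of_def[symmetric]
  proof (rule the_equality)
    show "\<exists>r. (\<forall>i. r i \<in> Z_slope \<theta> q) \<and> bullet_of \<UU> y = bullet_of \<UU> r \<and>
        limitin torus_topology (\<lambda>i. to_torus (r i) (r i * \<theta>)) (to_torus a b) \<UU>"
      using approaches_imp_limitin[OF ab] y(2) by blast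
  qed (use approaches_limit_unique[OF ab] in blast)
qed

lemma of_standard_in_bullet_Z_slope_iff:
  "of_standard \<UU> r \<in> bullet_Z_slope \<UU> \<theta> q \<longleftrightarrow> r \<in> Z_slope \<theta> q"
  by (simp add: bullet_Z_slope_iff line_limit_of_standard Z_slope_def) (simp add: of_standard_eq)

end

section \<open>The section topology as a product\<close>

context irrational_line
begin

sublocale bullet: comm_group "bullet_reals \<UU>"
  by (rule comm_group_bullet)

sublocale torus: comm_group torus
  by (rule comm_group_torus)

sublocale limit: group_hom "bullet_reals \<UU>" torus "line_limit \<UU> \<theta>"
  by unfold_locales (auto simp: hom_def line_limit_carrier line_limit_mult)

lemma bullet_Z_theta_eq_kernel:
  "bullet_Z_theta \<UU> \<theta> = kernel (bullet_reals \<UU>) torus (line_limit \<UU> \<theta>)"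
proof -
  have "bullet_Z_theta \<UU> \<theta> \<subseteq> carrier (bullet_reals \<UU>)"
    unfolding bullet_Z_theta_eq by auto
  with line_limit_kernel show ?thesis by (auto simp: kernel_def)
qed

lemma subgroup_bullet_Z_theta: "subgroup (bullet_Z_theta \<UU> \<theta>) (bullet_reals \<UU>)"
  unfolding bullet_Z_theta_eq_kernel by (rule limit.subgroup_kernel)

lemma bullet_Z_theta_carrier: "n \<in> bullet_Z_theta \<UU> \<theta> \<Longrightarrow> n \<in> carrier (bullet_reals \<UU>)"
  by (simp add: bullet_Z_theta_eq_kernel kernel_def)

lemma line_limit_bullet_Z_theta: "n \<in> bullet_Z_theta \<UU> \<theta> \<Longrightarrow> line_limit \<UU> \<theta> n = \<one>\<^bsub>torus\<^esub>"
  by (simp add: bullet_Z_theta_eq_kernel kernel_def)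

lemma line_limit_eq_iff:
  assumes "x \<in> carrier (bullet_reals \<UU>)" "y \<in> carrier (bullet_reals \<UU>)"
  shows "line_limit \<UU> \<theta> x = line_limit \<UU> \<theta> y \<longleftrightarrow>
    x \<otimes>\<^bsub>bullet_reals \<UU>\<^esub> inv\<^bsub>bullet_reals \<UU>\<^esub> y \<in> bullet_Z_theta \<UU> \<theta>"
proof -
  have "x \<otimes>\<^bsub>bullet_reals \<UU>\<^esub> inv\<^bsub>bullet_reals \<UU>\<^esub> y \<in> bullet_Z_theta \<UU> \<theta> \<longleftrightarrow>
      line_limit \<UU> \<theta> x \<otimes>\<^bsub>torus\<^esub> inv\<^bsub>torus\<^esub> line_limit \<UU> \<theta> y = \<one>\<^bsub>torus\<^esub>"
    using assms by (simp add: bullet_Z_theta_eq_kernel kernel_def)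
  also have "\<dots> \<longleftrightarrow> line_limit \<UU> \<theta> x = line_limit \<UU> \<theta> y"
    using assms by (metis limit.hom_closed torus.inv_closed torus.inv_equality torus.inv_inv torus.r_inv)
  finally show ?thesis ..
qed

lemma of_standard_carrier [simp]: "of_standard \<UU> r \<in> carrier (bullet_reals \<UU>)"
  by (simp add: of_standard_eq)

lemma of_standard_add:
  "of_standard \<UU> r \<otimes>\<^bsub>bullet_reals \<UU>\<^esub> of_standard \<UU> s = of_standard \<UU> (r + s)"
  by (simp add: of_standard_eq)

lemma torus_decomposition:
  assumes "u \<in> carrier torus"
  obtains r t where "t \<in> torus_line q" "u = to_torus r (r * \<theta>) \<otimes>\<^bsub>torus\<^esub> t"
proof -
  from assms obtain x y where u: "u = to_torus x y" by (rule carrier_torusE)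
  have "(x, y) \<in> range (line_coordinates \<theta> q)"
    using homeomorphic_imp_surjective_map[OF homeomorphic_map_line_coordinates[OF irrational]] by simp
  then obtain r w where "x = r + w * run q" "y = r * \<theta> + w * rise q"
    by (auto simp: line_coordinates_def)
  then show ?thesis
    by (intro that[of "to_torus (w * run q) (w * rise q)" r]) (auto simp: torus_line_eq u)
qed

end

locale bullet_section = irrational_line +
  fixes q :: slope and \<sigma> :: "real set \<times> real set \<Rightarrow> bullet"
  assumes equivariant: "equivariant_section \<UU> \<theta> q \<sigma>"
begin

lemma section_in_bullet_Z_slope: "t \<in> torus_line q \<Longrightarrow> \<sigma> t \<in> bullet_Z_slope \<UU> \<theta> q"
  using equivariant by (simp add: equivariant_section_def)

lemma section_carrier: "t \<in> torus_line q \<Longrightarrow> \<sigma> t \<in> carrier (bullet_reals \<UU>)"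
  using section_in_bullet_Z_slope bullet_Z_slope_iff by blast

lemma line_limit_section: "t \<in> torus_line q \<Longrightarrow> line_limit \<UU> \<theta> (\<sigma> t) = t"
  using equivariant limit_map_eq_line_limit[OF section_in_bullet_Z_slope]
  by (simp add: equivariant_section_def)

lemma section_equivariant:
  assumes "t \<in> torus_line q" "n \<in> Z_slope \<theta> q"
  shows "\<sigma> (to_torus n (n * \<theta>) \<otimes>\<^bsub>torus\<^esub> t) = of_standard \<UU> n \<otimes>\<^bsub>bullet_reals \<UU>\<^esub> \<sigma> t"
proof -
  have limit: "limit_map \<UU> \<theta> q (of_standard \<UU> n) = to_torus n (n * \<theta>)"
    using assms(2) by (simp add: limit_map_eq_line_limit of_standard_in_bullet_Z_slope_iff line_limit_of_standard)
  have "\<sigma> (limit_map \<UU> \<theta> q (of_standard \<UU> n) \<otimes>\<^bsub>torus\<^esub> t)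
      = of_standard \<UU> n \<otimes>\<^bsub>bullet_reals \<UU>\<^esub> \<sigma> t"
    using assms equivariant by (simp add: equivariant_section_def)
  then show ?thesis by (simp only: limit)
qed

text \<open>
  The decomposition of \<open>u\<close> is not unique, hence the choice;
  \<open>section_translate_unique\<close> shows that the value does not depend on it.
\<close>

definition global_section :: "real set \<times> real set \<Rightarrow> bullet" where
  "global_section u = (SOME x. \<exists>r. \<exists>t\<in>torus_line q. u = to_torus r (r * \<theta>) \<otimes>\<^bsub>torus\<^esub> t \<and>
     x = of_standard \<UU> r \<otimes>\<^bsub>bullet_reals \<UU>\<^esub> \<sigma> t)"

text \<open>
  Two decompositions of the same point differ by an element \<open>r - r'\<close> of
  \<open>\<int>\<^sub>q\<close>, and equivariance moves it through \<open>\<sigma>\<close>.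
\<close>

lemma section_translate_unique:
  assumes t: "t \<in> torus_line q" and t': "t' \<in> torus_line q"
    and eq: "to_torus r (r * \<theta>) \<otimes>\<^bsub>torus\<^esub> t = to_torus r' (r' * \<theta>) \<otimes>\<^bsub>torus\<^esub> t'"
  shows "of_standard \<UU> r \<otimes>\<^bsub>bullet_reals \<UU>\<^esub> \<sigma> t = of_standard \<UU> r' \<otimes>\<^bsub>bullet_reals \<UU>\<^esub> \<sigma> t'"
proof -
  from t t' obtain w w' where w: "t = to_torus (w * run q) (w * rise q)"
    "t' = to_torus (w' * run q) (w' * rise q)"
    by (auto simp: torus_line_eq)
  let ?k = "r - r'"
  have int: "?k - (w' - w) * run q \<in> \<int>" "?k * \<theta> - (w' - w) * rise q \<in> \<int>"
    using eq by (simp_all add: w to_torus_eq_iff algebra_simps)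
  then have "to_torus ?k (?k * \<theta>) = to_torus ((w' - w) * run q) ((w' - w) * rise q)"
    by (simp only: to_torus_eq_iff)
  then have k: "?k \<in> Z_slope \<theta> q"
    unfolding Z_slope_def torus_line_eq by blast
  have t'_eq: "t' = to_torus ?k (?k * \<theta>) \<otimes>\<^bsub>torus\<^esub> t"
    using int[THEN Ints_minus] by (simp add: w to_torus_eq_iff algebra_simps)
  have "of_standard \<UU> r' \<otimes>\<^bsub>bullet_reals \<UU>\<^esub> \<sigma> t'
      = of_standard \<UU> r' \<otimes>\<^bsub>bullet_reals \<UU>\<^esub> (of_standard \<UU> ?k \<otimes>\<^bsub>bullet_reals \<UU>\<^esub> \<sigma> t)"
    by (simp only: t'_eq section_equivariant[OF t k])
  also have "\<dots> = of_standard \<UU> r \<otimes>\<^bsub>bullet_reals \<UU>\<^esub> \<sigma> t"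
    using t by (simp add: bullet.m_assoc[symmetric] section_carrier of_standard_add)
  finally show ?thesis ..
qed

lemma global_section_eq:
  assumes "t \<in> torus_line q"
  shows "global_section (to_torus r (r * \<theta>) \<otimes>\<^bsub>torus\<^esub> t) = of_standard \<UU> r \<otimes>\<^bsub>bullet_reals \<UU>\<^esub> \<sigma> t"
  unfolding global_section_def
  by (rule some_equality) (use assms section_translate_unique in blast)+

lemma global_section_carrier: "u \<in> carrier torus \<Longrightarrow> global_section u \<in> carrier (bullet_reals \<UU>)"
  by (erule torus_decomposition[where q = q]) (simp add: global_section_eq section_carrier)

lemma line_limit_global_section: "u \<in> carrier torus \<Longrightarrow> line_limit \<UU> \<theta> (global_section u) = u"
  by (erule torus_decomposition[where q = q])
    (simp add: global_section_eq section_carrier line_limit_section line_limit_of_standard)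

definition trivialization :: "(real set \<times> real set) \<times> bullet \<Rightarrow> bullet" where
  "trivialization = (\<lambda>(u, n). global_section u \<otimes>\<^bsub>bullet_reals \<UU>\<^esub> n)"

text \<open>
  The disjoint union of copies of the torus, one for each element of the kernel.
\<close>

abbreviation sheets_topology :: "((real set \<times> real set) \<times> bullet) topology" where
  "sheets_topology \<equiv> prod_topology torus_topology (discrete_topology (bullet_Z_theta \<UU> \<theta>))"

lemma line_limit_trivialization:
  assumes "u \<in> carrier torus" "n \<in> bullet_Z_theta \<UU> \<theta>"
  shows "line_limit \<UU> \<theta> (trivialization (u, n)) = u"
  using assms
  by (simp add: trivialization_def bullet_Z_theta_carrier global_section_carrier
      line_limit_global_section line_limit_bullet_Z_theta)

lemma inj_on_trivialization: "inj_on trivialization (carrier torus \<times> bullet_Z_theta \<UU> \<theta>)"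
proof (rule inj_onI, clarify)
  fix u u' :: "real set \<times> real set" and n n'
  assume u: "u \<in> carrier torus" "u' \<in> carrier torus"
    and n: "n \<in> bullet_Z_theta \<UU> \<theta>" "n' \<in> bullet_Z_theta \<UU> \<theta>"
    and eq: "trivialization (u, n) = trivialization (u', n')"
  have "u = u'"
    using arg_cong[OF eq, of "line_limit \<UU> \<theta>"] u n by (simp add: line_limit_trivialization)
  moreover from this have "n = n'"
    using eq u n by (simp add: trivialization_def bullet_Z_theta_carrier global_section_carrier)
  ultimately show "u = u' \<and> n = n'" ..
qed

lemma trivialization_surj:
  "trivialization ` (carrier torus \<times> bullet_Z_theta \<UU> \<theta>) = carrier (bullet_reals \<UU>)"
proof (intro equalityI subsetI)
  fix x assume x: "x \<in> carrier (bullet_reals \<UU>)"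
  let ?u = "line_limit \<UU> \<theta> x"
  let ?n = "x \<otimes>\<^bsub>bullet_reals \<UU>\<^esub> inv\<^bsub>bullet_reals \<UU>\<^esub> global_section ?u"
  have u: "?u \<in> carrier torus" using x by simp
  then have "?n \<in> bullet_Z_theta \<UU> \<theta>"
    using x line_limit_eq_iff[of x "global_section ?u"]
    by (simp add: global_section_carrier line_limit_global_section)
  moreover have "x = trivialization (?u, ?n)"
    using x global_section_carrier[OF u]
    by (simp add: trivialization_def bullet.m_lcomm)
  ultimately show "x \<in> trivialization ` (carrier torus \<times> bullet_Z_theta \<UU> \<theta>)"
    using u by blast
qed (auto simp: trivialization_def global_section_carrier bullet_Z_theta_carrier)

lemma homeomorphic_map_transversal:
  "homeomorphic_map
     (prod_topology (subtopology torus_topology (torus_line q)) (discrete_topology (bullet_Z_theta \<UU> \<theta>)))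
     (transversal_topology \<UU> \<theta> q \<sigma>) (\<lambda>(t, n). \<sigma> t \<otimes>\<^bsub>bullet_reals \<UU>\<^esub> n)"
  unfolding homeomorphic_map_def transversal_topology_def
proof (intro conjI quotient_map_quotient_topology)
  have eq: "\<sigma> t \<otimes>\<^bsub>bullet_reals \<UU>\<^esub> n = trivialization (t, n)" if "t \<in> torus_line q" for t n
  proof -
    have "to_torus 0 (0 * \<theta>) \<otimes>\<^bsub>torus\<^esub> t = t"
      using subsetD[OF torus_line_subset that] by (simp add: one_torus[symmetric])
    moreover have "of_standard \<UU> 0 \<otimes>\<^bsub>bullet_reals \<UU>\<^esub> \<sigma> t = \<sigma> t"
      using that by (simp add: of_standard_eq one_bullet[symmetric] section_carrier)
    ultimately have "global_section t = \<sigma> t"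
      using global_section_eq[OF that, of 0] by simp
    then show ?thesis by (simp add: trivialization_def)
  qed
  let ?S = "topspace (prod_topology (subtopology torus_topology (torus_line q))
        (discrete_topology (bullet_Z_theta \<UU> \<theta>)))"
  have "inj_on trivialization ?S"
    by (rule inj_on_subset[OF inj_on_trivialization]) auto
  moreover have "inj_on (\<lambda>(t, n). \<sigma> t \<otimes>\<^bsub>bullet_reals \<UU>\<^esub> n) ?S = inj_on trivialization ?S"
    by (rule inj_on_cong) (auto simp: eq)
  ultimately show "inj_on (\<lambda>(t, n). \<sigma> t \<otimes>\<^bsub>bullet_reals \<UU>\<^esub> n) ?S"
    by simp
qed

text \<open>
  Openness is checked after parametrizing the line of slope \<open>q\<close> by the reals: the map then
  becomes the covering map of the torus after a linear isomorphism of the plane, times the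
  identity of the discrete factor.
\<close>

lemma quotient_map_leaf_times_transversal:
  "quotient_map
     (prod_topology euclideanreal
       (prod_topology (subtopology torus_topology (torus_line q)) (discrete_topology (bullet_Z_theta \<UU> \<theta>))))
     sheets_topology (\<lambda>(r, t, n). (to_torus r (r * \<theta>) \<otimes>\<^bsub>torus\<^esub> t, n))"
  (is "quotient_map (prod_topology _ (prod_topology ?T ?D)) _ ?k")
proof (rule continuous_open_imp_quotient_map)
  let ?A = "prod_topology euclideanreal (prod_topology ?T ?D)"
  let ?j = "\<lambda>((r, w), n). (r, to_torus (w * run q) (w * rise q), n)"
  let ?B = "prod_topology (euclidean :: (real \<times> real) topology) ?D"
  have line: "torus_cover \<circ> (\<lambda>r. (r, r * \<theta>)) = (\<lambda>r. to_torus r (r * \<theta>))"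
    "torus_cover \<circ> (\<lambda>w. (w * run q, w * rise q)) = (\<lambda>w. to_torus (w * run q) (w * rise q))"
    by auto
  have cont_line: "continuous_map euclideanreal torus_topology (\<lambda>r. to_torus r (r * \<theta>))"
    "continuous_map euclideanreal torus_topology (\<lambda>w. to_torus (w * run q) (w * rise q))"
    unfolding line[symmetric]
    by (rule continuous_map_compose[OF _ continuous_map_torus_cover], simp, intro continuous_intros)+
  show "continuous_map ?A sheets_topology ?k"
  proof -
    have "continuous_map ?A (prod_topology torus_topology torus_topology)
        (\<lambda>p. (to_torus (fst p) (fst p * \<theta>), fst (snd p)))"
      unfolding continuous_map_pairwise comp_def fst_conv snd_conv
      using continuous_map_compose[OF continuous_map_fst cont_line(1)]
        continuous_map_into_fulltopology[OF continuous_map_compose[OF continuous_map_snd continuous_map_fst]]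
      by (auto simp: comp_def)
    from continuous_map_compose[OF this continuous_map_torus_add]
    have 1: "continuous_map ?A torus_topology (fst \<circ> ?k)"
      by (simp add: comp_def case_prod_unfold)
    have 2: "continuous_map ?A ?D (snd \<circ> ?k)"
      using continuous_map_compose[OF continuous_map_snd continuous_map_snd]
      by (auto simp: comp_def case_prod_unfold)
    from 1 2 show ?thesis by (simp only: continuous_map_pairwise)
  qed
  show "open_map ?A sheets_topology ?k"
  proof (rule open_map_from_composition_left)
    have "open_map ?B sheets_topology
        (\<lambda>(p, n). ((torus_cover \<circ> line_coordinates \<theta> q) p, id n))"
      by (intro open_map_prod open_map_id open_map_compose[OF _ open_map_torus_cover]
          homeomorphic_imp_open_map homeomorphic_map_line_coordinates irrational)
    moreover have "(\<lambda>(p, n). ((torus_cover \<circ> line_coordinates \<theta> q) p, id n)) = ?k \<circ> ?j"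
      by (auto simp: line_coordinates_def)
    ultimately show "open_map ?B sheets_topology (?k \<circ> ?j)" by simp
    show "continuous_map ?B ?A ?j"
    proof -
      have "continuous_map ?B euclideanreal (fst \<circ> fst)" "continuous_map ?B euclideanreal (snd \<circ> fst)"
        by (rule continuous_map_compose[OF continuous_map_fst],
            simp add: continuous_on_fst continuous_on_snd continuous_on_id)+
      note c = this
      have "continuous_map ?B ?T (\<lambda>p. to_torus (snd (fst p) * run q) (snd (fst p) * rise q))"
        using continuous_map_compose[OF c(2) cont_line(2)]
        by (auto simp: continuous_map_in_subtopology comp_def torus_line_eq)
      moreover have "continuous_map ?B ?D snd" by (rule continuous_map_snd)
      ultimately show ?thesis
        using c(1) by (auto simp: continuous_map_pairwise case_prod_unfold comp_def)
    qed
    show "?j ` topspace ?B = topspace ?A"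
      using torus_line_subset by (force simp: torus_line_eq image_iff)
  qed
  show "?k ` topspace ?A = topspace sheets_topology"
  proof (intro equalityI subsetI)
    fix p assume "p \<in> topspace sheets_topology"
    then obtain u n where p: "p = (u, n)" "u \<in> carrier torus" "n \<in> bullet_Z_theta \<UU> \<theta>" by auto
    from p(2) obtain r t where "t \<in> torus_line q" "u = to_torus r (r * \<theta>) \<otimes>\<^bsub>torus\<^esub> t"
      by (rule torus_decomposition)
    then show "p \<in> ?k ` topspace ?A"
      using p torus_line_subset by (intro image_eqI[of _ _ "(r, t, n)"]) auto
  qed (use torus_line_subset in auto)
qed

text \<open>
  The composite of the trivialization with the quotient map
  \<open>(r, t, n) \<mapsto> ((r, r * \<theta>) + t, n)\<close> is the quotient map
  \<open>(r, t, n) \<mapsto> r + (\<sigma> t + n)\<close> that defines the section topology.  Hence the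
  trivialization is itself a quotient map, and it is injective.
\<close>

theorem homeomorphic_map_trivialization:
  "homeomorphic_map sheets_topology (section_topology \<UU> \<theta> q \<sigma>) trivialization"
  unfolding homeomorphic_map_def
proof
  let ?T = "prod_topology (subtopology torus_topology (torus_line q)) (discrete_topology (bullet_Z_theta \<UU> \<theta>))"
  let ?A = "prod_topology euclideanreal ?T"
  let ?k = "\<lambda>(r, t, n). (to_torus r (r * \<theta>) \<otimes>\<^bsub>torus\<^esub> t, n)"
  let ?f = "\<lambda>(t, n). \<sigma> t \<otimes>\<^bsub>bullet_reals \<UU>\<^esub> n"
  let ?g = "\<lambda>(r, m). of_standard \<UU> r \<otimes>\<^bsub>bullet_reals \<UU>\<^esub> m"
  have "homeomorphic_map ?A (prod_topology euclideanreal (transversal_topology \<UU> \<theta> q \<sigma>))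
      (\<lambda>(r, p). (id r, ?f p))"
    by (rule homeomorphic_map_prod[OF iffD2[OF homeomorphic_map_id refl] homeomorphic_map_transversal])
  then have "quotient_map ?A (section_topology \<UU> \<theta> q \<sigma>) (?g \<circ> (\<lambda>(r, p). (id r, ?f p)))"
    unfolding section_topology_def
    by (intro quotient_map_compose[OF _ quotient_map_quotient_topology]) (simp add: homeomorphic_map_def)
  then have "quotient_map ?A (section_topology \<UU> \<theta> q \<sigma>) (trivialization \<circ> ?k)"
    by (rule quotient_map_eq)
      (auto simp: trivialization_def global_section_eq section_carrier bullet_Z_theta_carrier bullet.m_assoc)
  then show "quotient_map sheets_topology (section_topology \<UU> \<theta> q \<sigma>) trivialization"
    by (simp only: quotient_map_compose_eq[OF quotient_map_leaf_times_transversal])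
  show "inj_on trivialization (topspace sheets_topology)"
    using inj_on_trivialization by simp
qed

lemma topspace_section_topology [simp]:
  "topspace (section_topology \<UU> \<theta> q \<sigma>) = carrier (bullet_reals \<UU>)"
  using homeomorphic_imp_surjective_map[OF homeomorphic_map_trivialization] trivialization_surj by simp

end

section \<open>The action of the kernel\<close>

lemma homeomorphic_map_conjugate:
  assumes e: "homeomorphic_map X Y e" and f: "homeomorphic_map X X f"
    and conj: "\<And>x. x \<in> topspace X \<Longrightarrow> g (e x) = e (f x)"
    and inj: "inj_on g (topspace Y)"
  shows "homeomorphic_map Y Y g"
  unfolding homeomorphic_map_def
proof
  have "homeomorphic_map X Y (e \<circ> f)" by (rule homeomorphic_map_compose[OF f e])
  then have "homeomorphic_map X Y (g \<circ> e)"
    by (rule homeomorphic_map_eq) (simp add: conj)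
  moreover have "quotient_map X Y e" using e by (simp add: homeomorphic_map_def)
  ultimately show "quotient_map Y Y g"
    by (simp add: homeomorphic_map_def quotient_map_compose_eq)
qed (rule inj)

context irrational_line
begin

lemma topspace_bullet_leaf:
  "topspace (bullet_leaf \<UU> x) = {x \<otimes>\<^bsub>bullet_reals \<UU>\<^esub> of_standard \<UU> r | r. True}"
  by (auto simp: bullet_leaf_def topspace_quotient_topology)

lemma topspace_bullet_leaf_subset:
  "x \<in> carrier (bullet_reals \<UU>) \<Longrightarrow> topspace (bullet_leaf \<UU> x) \<subseteq> carrier (bullet_reals \<UU>)"
  by (auto simp: topspace_bullet_leaf)

lemma bullet_leaves_carrier:
  "L \<in> bullet_leaves \<UU> \<Longrightarrow> topspace L \<subseteq> carrier (bullet_reals \<UU>)"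
  using topspace_bullet_leaf_subset by (auto simp: bullet_leaves_def)

lemma translate_bullet_leaf:
  assumes "n \<in> carrier (bullet_reals \<UU>)" "x \<in> carrier (bullet_reals \<UU>)"
  shows "(\<lambda>x. n \<otimes>\<^bsub>bullet_reals \<UU>\<^esub> x) ` topspace (bullet_leaf \<UU> x)
    = topspace (bullet_leaf \<UU> (n \<otimes>\<^bsub>bullet_reals \<UU>\<^esub> x))"
  using assms by (force simp: topspace_bullet_leaf bullet.m_assoc)

lemma bij_betw_translate_leaves:
  assumes n: "n \<in> carrier (bullet_reals \<UU>)"
  shows "bij_betw (\<lambda>\<Lambda>. (\<lambda>x. n \<otimes>\<^bsub>bullet_reals \<UU>\<^esub> x) ` \<Lambda>)
    (topspace ` bullet_leaves \<UU>) (topspace ` bullet_leaves \<UU>)"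
proof -
  have inj: "inj_on (\<lambda>x. n \<otimes>\<^bsub>bullet_reals \<UU>\<^esub> x) (carrier (bullet_reals \<UU>))"
    using n by (simp add: inj_on_def)
  have "inj_on (\<lambda>\<Lambda>. (\<lambda>x. n \<otimes>\<^bsub>bullet_reals \<UU>\<^esub> x) ` \<Lambda>) (topspace ` bullet_leaves \<UU>)"
    using bullet_leaves_carrier by (intro inj_on_subset[OF inj_on_image_Pow[OF inj]]) blast
  moreover have "(\<lambda>\<Lambda>. (\<lambda>x. n \<otimes>\<^bsub>bullet_reals \<UU>\<^esub> x) ` \<Lambda>) ` topspace ` bullet_leaves \<UU> = topspace ` bullet_leaves \<UU>"
  proof (intro equalityI subsetI)
    fix \<Lambda> assume "\<Lambda> \<in> topspace ` bullet_leaves \<UU>"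
    then obtain x where x: "x \<in> carrier (bullet_reals \<UU>)" "\<Lambda> = topspace (bullet_leaf \<UU> x)"
      by (auto simp: bullet_leaves_def)
    let ?y = "inv\<^bsub>bullet_reals \<UU>\<^esub> n \<otimes>\<^bsub>bullet_reals \<UU>\<^esub> x"
    have "n \<otimes>\<^bsub>bullet_reals \<UU>\<^esub> ?y = x"
      using n x(1) by (simp add: bullet.m_assoc[symmetric])
    then have "\<Lambda> = (\<lambda>x. n \<otimes>\<^bsub>bullet_reals \<UU>\<^esub> x) ` topspace (bullet_leaf \<UU> ?y)"
      using n x translate_bullet_leaf[of n ?y] by simp
    moreover have "?y \<in> carrier (bullet_reals \<UU>)" using n x(1) by simp
    ultimately show "\<Lambda> \<in> (\<lambda>\<Lambda>. (\<lambda>x. n \<otimes>\<^bsub>bullet_reals \<UU>\<^esub> x) ` \<Lambda>) ` topspace ` bullet_leaves \<UU>"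
      unfolding bullet_leaves_def by blast
  next
    fix \<Lambda> assume "\<Lambda> \<in> (\<lambda>\<Lambda>. (\<lambda>x. n \<otimes>\<^bsub>bullet_reals \<UU>\<^esub> x) ` \<Lambda>) ` topspace ` bullet_leaves \<UU>"
    then obtain x where x: "x \<in> carrier (bullet_reals \<UU>)"
      "\<Lambda> = (\<lambda>x. n \<otimes>\<^bsub>bullet_reals \<UU>\<^esub> x) ` topspace (bullet_leaf \<UU> x)"
      by (auto simp: bullet_leaves_def)
    then have "\<Lambda> = topspace (bullet_leaf \<UU> (n \<otimes>\<^bsub>bullet_reals \<UU>\<^esub> x))"
      using n translate_bullet_leaf by simp
    moreover have "n \<otimes>\<^bsub>bullet_reals \<UU>\<^esub> x \<in> carrier (bullet_reals \<UU>)" using n x(1) by simp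
    ultimately show "\<Lambda> \<in> topspace ` bullet_leaves \<UU>"
      unfolding bullet_leaves_def by blast
  qed
  ultimately show ?thesis by (simp add: bij_betw_def)
qed

lemma leaf_dist_translate:
  assumes "n \<in> carrier (bullet_reals \<UU>)" "x \<in> carrier (bullet_reals \<UU>)" "y \<in> carrier (bullet_reals \<UU>)"
  shows "leaf_dist \<UU> (n \<otimes>\<^bsub>bullet_reals \<UU>\<^esub> x) (n \<otimes>\<^bsub>bullet_reals \<UU>\<^esub> y) = leaf_dist \<UU> x y"
  using assms by (simp add: leaf_dist_def bullet.m_assoc)

lemma translate_bullet_Z_slope:
  assumes n: "n \<in> bullet_Z_theta \<UU> \<theta>"
  shows "(\<lambda>x. n \<otimes>\<^bsub>bullet_reals \<UU>\<^esub> x) ` bullet_Z_slope \<UU> \<theta> q = bullet_Z_slope \<UU> \<theta> q"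
proof -
  have sub: "n' \<otimes>\<^bsub>bullet_reals \<UU>\<^esub> m \<in> bullet_Z_slope \<UU> \<theta> q"
    if "n' \<in> bullet_Z_theta \<UU> \<theta>" "m \<in> bullet_Z_slope \<UU> \<theta> q" for n' m
    using that by (simp add: bullet_Z_slope_iff bullet_Z_theta_carrier line_limit_bullet_Z_theta)
  have "m \<in> (\<lambda>x. n \<otimes>\<^bsub>bullet_reals \<UU>\<^esub> x) ` bullet_Z_slope \<UU> \<theta> q"
    if m: "m \<in> bullet_Z_slope \<UU> \<theta> q" for m
  proof (rule image_eqI)
    show "inv\<^bsub>bullet_reals \<UU>\<^esub> n \<otimes>\<^bsub>bullet_reals \<UU>\<^esub> m \<in> bullet_Z_slope \<UU> \<theta> q"
      by (rule sub[OF subgroup.m_inv_closed[OF subgroup_bullet_Z_theta n] m])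
    show "m = n \<otimes>\<^bsub>bullet_reals \<UU>\<^esub> (inv\<^bsub>bullet_reals \<UU>\<^esub> n \<otimes>\<^bsub>bullet_reals \<UU>\<^esub> m)"
      using n m by (simp add: bullet.m_assoc[symmetric] bullet_Z_theta_carrier bullet_Z_slope_iff)
  qed
  with sub[OF n] show ?thesis by blast
qed

end

context bullet_section
begin

text \<open>
  In the trivialization the kernel acts by permuting the sheets only.  This gives the
  continuity of the translations and both forms of proper discontinuity.
\<close>

lemma translate_trivialization:
  assumes "u \<in> carrier torus" "m \<in> bullet_Z_theta \<UU> \<theta>" "n \<in> bullet_Z_theta \<UU> \<theta>"
  shows "n \<otimes>\<^bsub>bullet_reals \<UU>\<^esub> trivialization (u, m) = trivialization (u, n \<otimes>\<^bsub>bullet_reals \<UU>\<^esub> m)"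
  using assms by (simp add: trivialization_def bullet.m_lcomm bullet_Z_theta_carrier global_section_carrier)

lemma homeomorphic_map_translate:
  assumes n: "n \<in> bullet_Z_theta \<UU> \<theta>"
  shows "homeomorphic_map (section_topology \<UU> \<theta> q \<sigma>) (section_topology \<UU> \<theta> q \<sigma>)
    (\<lambda>x. n \<otimes>\<^bsub>bullet_reals \<UU>\<^esub> x)"
proof (rule homeomorphic_map_conjugate[OF homeomorphic_map_trivialization])
  interpret Z: subgroup "bullet_Z_theta \<UU> \<theta>" "bullet_reals \<UU>"
    by (rule subgroup_bullet_Z_theta)
  let ?D = "discrete_topology (bullet_Z_theta \<UU> \<theta>)"
  have "homeomorphic_map ?D ?D (\<lambda>m. n \<otimes>\<^bsub>bullet_reals \<UU>\<^esub> m)"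
  proof (rule bijective_open_imp_homeomorphic_map)
    show "(\<lambda>m. n \<otimes>\<^bsub>bullet_reals \<UU>\<^esub> m) ` topspace ?D = topspace ?D"
    proof (intro equalityI subsetI)
      fix m assume "m \<in> topspace ?D"
      then show "m \<in> (\<lambda>m. n \<otimes>\<^bsub>bullet_reals \<UU>\<^esub> m) ` topspace ?D"
        using n by (intro image_eqI[of _ _ "inv\<^bsub>bullet_reals \<UU>\<^esub> n \<otimes>\<^bsub>bullet_reals \<UU>\<^esub> m"])
          (simp_all add: bullet.m_assoc[symmetric])
    qed (use n in auto)
    show "inj_on (\<lambda>m. n \<otimes>\<^bsub>bullet_reals \<UU>\<^esub> m) (topspace ?D)"
      using n by (auto simp: inj_on_def)
  qed (use n in \<open>auto simp: open_map_into_discrete_topology\<close>)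
  then show "homeomorphic_map sheets_topology sheets_topology
      (\<lambda>(u, m). (id u, n \<otimes>\<^bsub>bullet_reals \<UU>\<^esub> m))"
    by (rule homeomorphic_map_prod[OF iffD2[OF homeomorphic_map_id refl]])
  show "inj_on (\<lambda>x. n \<otimes>\<^bsub>bullet_reals \<UU>\<^esub> x) (topspace (section_topology \<UU> \<theta> q \<sigma>))"
    using n by (auto simp: inj_on_def)
qed (use n in \<open>auto simp: translate_trivialization\<close>)

lemma properly_discontinuous_bullet_Z_theta:
  "properly_discontinuous (bullet_reals \<UU>\<lparr>carrier := bullet_Z_theta \<UU> \<theta>\<rparr>)
     (section_topology \<UU> \<theta> q \<sigma>) (\<lambda>n x. n \<otimes>\<^bsub>bullet_reals \<UU>\<^esub> x)"
  unfolding properly_discontinuous_def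
proof (intro conjI ballI allI impI)
  interpret Z: subgroup "bullet_Z_theta \<UU> \<theta>" "bullet_reals \<UU>"
    by (rule subgroup_bullet_Z_theta)
  let ?Z = "bullet_Z_theta \<UU> \<theta>"
  fix x assume "x \<in> topspace (section_topology \<UU> \<theta> q \<sigma>)"
  then have "x \<in> trivialization ` (carrier torus \<times> ?Z)"
    by (simp only: trivialization_surj topspace_section_topology)
  then obtain u n where x: "u \<in> carrier torus" "n \<in> ?Z" "x = trivialization (u, n)"
    by (elim imageE SigmaE) simp
  \<comment> \<open>a whole sheet is disjoint from its nontrivial translates\<close>
  let ?U = "trivialization ` (carrier torus \<times> {n})"
  have "openin (section_topology \<UU> \<theta> q \<sigma>) ?U"
  proof -
    have "openin sheets_topology (topspace torus_topology \<times> {n})"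
      using x(2) by (simp only: openin_prod_Times_iff openin_topspace openin_discrete_topology) simp
    then show ?thesis
      using homeomorphic_imp_open_map[OF homeomorphic_map_trivialization] by (simp add: open_map_def)
  qed
  moreover have "x \<in> ?U" using x by blast
  moreover have "(\<lambda>x. g \<otimes>\<^bsub>bullet_reals \<UU>\<^esub> x) ` ?U \<inter> ?U = {}"
    if g: "g \<in> ?Z" "g \<noteq> \<one>\<^bsub>bullet_reals \<UU>\<^esub>" for g
  proof (rule ccontr)
    assume "(\<lambda>x. g \<otimes>\<^bsub>bullet_reals \<UU>\<^esub> x) ` ?U \<inter> ?U \<noteq> {}"
    then obtain v w where vw: "v \<in> carrier torus" "w \<in> carrier torus"
      "g \<otimes>\<^bsub>bullet_reals \<UU>\<^esub> trivialization (v, n) = trivialization (w, n)" by blast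
    then have "trivialization (v, g \<otimes>\<^bsub>bullet_reals \<UU>\<^esub> n) = trivialization (w, n)"
      using g x by (simp add: translate_trivialization)
    then have "(v, g \<otimes>\<^bsub>bullet_reals \<UU>\<^esub> n) = (w, n)"
      by (rule inj_onD[OF inj_on_trivialization]) (use vw g x in auto)
    then show False using g x by simp
  qed
  ultimately show "\<exists>U. openin (section_topology \<UU> \<theta> q \<sigma>) U \<and> x \<in> U \<and>
      (\<forall>g\<in>carrier (bullet_reals \<UU>\<lparr>carrier := ?Z\<rparr>).
        g \<noteq> \<one>\<^bsub>bullet_reals \<UU>\<lparr>carrier := ?Z\<rparr>\<^esub> \<longrightarrow> (\<lambda>x. g \<otimes>\<^bsub>bullet_reals \<UU>\<^esub> x) ` U \<inter> U = {})"
    by (intro exI[of _ ?U]) simp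
next
  interpret Z: subgroup "bullet_Z_theta \<UU> \<theta>" "bullet_reals \<UU>"
    by (rule subgroup_bullet_Z_theta)
  let ?Z = "bullet_Z_theta \<UU> \<theta>"
  fix K assume K: "compactin (section_topology \<UU> \<theta> q \<sigma>) K"
  let ?K = "{p \<in> carrier torus \<times> ?Z. trivialization p \<in> K}"
  have img: "trivialization ` ?K = K"
  proof -
    have "K \<subseteq> trivialization ` (carrier torus \<times> ?Z)"
      using compactin_subset_topspace[OF K] by (simp add: trivialization_surj)
    then show ?thesis by blast
  qed
  have "compactin sheets_topology ?K"
    using homeomorphic_map_compactness[OF homeomorphic_map_trivialization, of ?K] K img by auto
  then have "compactin (discrete_topology ?Z) (snd ` ?K)"
    by (rule image_compactin) (rule continuous_map_snd)
  then have fin: "finite (snd ` ?K)" by (simp add: compactin_discrete_topology)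
  \<comment> \<open>a translation moving \<open>K\<close> to meet itself is a difference of two sheets met by \<open>K\<close>\<close>
  have "{g \<in> ?Z. (\<lambda>x. g \<otimes>\<^bsub>bullet_reals \<UU>\<^esub> x) ` K \<inter> K \<noteq> {}}
      \<subseteq> (\<lambda>(m, n). n \<otimes>\<^bsub>bullet_reals \<UU>\<^esub> inv\<^bsub>bullet_reals \<UU>\<^esub> m) ` (snd ` ?K \<times> snd ` ?K)"
  proof
    fix g assume "g \<in> {g \<in> ?Z. (\<lambda>x. g \<otimes>\<^bsub>bullet_reals \<UU>\<^esub> x) ` K \<inter> K \<noteq> {}}"
    then obtain x where g: "g \<in> ?Z" and x: "x \<in> K" "g \<otimes>\<^bsub>bullet_reals \<UU>\<^esub> x \<in> K"
      by blast
    from x(1) img obtain p where p: "p \<in> ?K" "x = trivialization p" by blast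
    then obtain u m where um: "p = (u, m)" "u \<in> carrier torus" "m \<in> ?Z"
      by (cases p) auto
    have "(u, g \<otimes>\<^bsub>bullet_reals \<UU>\<^esub> m) \<in> ?K"
      using x(2) g um p by (simp add: translate_trivialization)
    then have "g \<otimes>\<^bsub>bullet_reals \<UU>\<^esub> m \<in> snd ` ?K" "m \<in> snd ` ?K"
      using p um by force+
    moreover have "g = g \<otimes>\<^bsub>bullet_reals \<UU>\<^esub> m \<otimes>\<^bsub>bullet_reals \<UU>\<^esub> inv\<^bsub>bullet_reals \<UU>\<^esub> m"
      using g um by (simp add: bullet.m_assoc)
    ultimately show "g \<in> (\<lambda>(m, n). n \<otimes>\<^bsub>bullet_reals \<UU>\<^esub> inv\<^bsub>bullet_reals \<UU>\<^esub> m) ` (snd ` ?K \<times> snd ` ?K)"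
      by (intro image_eqI[of _ _ "(m, g \<otimes>\<^bsub>bullet_reals \<UU>\<^esub> m)"]) simp_all
  qed
  then show "finite {g \<in> carrier (bullet_reals \<UU>\<lparr>carrier := ?Z\<rparr>).
      (\<lambda>x. g \<otimes>\<^bsub>bullet_reals \<UU>\<^esub> x) ` K \<inter> K \<noteq> {}}"
    using fin by (simp add: finite_subset)
qed

end

section \<open>The quotient\<close>

text \<open>
  Two quotient maps on the same space with the same fibres have homeomorphic targets.
\<close>

lemma homeomorphic_map_quotient_topology:
  assumes "quotient_map X Y f" "\<And>x. x \<in> topspace X \<Longrightarrow> g (p x) = f x"
    "\<And>x y. x \<in> topspace X \<Longrightarrow> y \<in> topspace X \<Longrightarrow> f x = f y \<Longrightarrow> p x = p y"
  shows "homeomorphic_map (quotient_topology X p) Y g"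
  unfolding homeomorphic_map_def
proof
  have "quotient_map X Y (g \<circ> p)"
    by (rule quotient_map_eq[OF assms(1)]) (simp add: assms(2))
  then show "quotient_map (quotient_topology X p) Y g"
    by (simp only: quotient_map_compose_eq[OF quotient_map_quotient_topology])
  show "inj_on g (topspace (quotient_topology X p))"
    unfolding topspace_quotient_topology
  proof (rule inj_onI, elim imageE)
    fix A B x y assume "g A = g B" "A = p x" "x \<in> topspace X" "B = p y" "y \<in> topspace X"
    then show "A = B" using assms(2)[of x] assms(2)[of y] assms(3)[of x y] by simp
  qed
qed

context irrational_line
begin

lemma orbit_map_eq_iff:
  assumes "x \<in> carrier (bullet_reals \<UU>)" "y \<in> carrier (bullet_reals \<UU>)"
  shows "orbit_map \<UU> \<theta> x = orbit_map \<UU> \<theta> y \<longleftrightarrow> line_limit \<UU> \<theta> x = line_limit \<UU> \<theta> y"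
  using assms bullet.rcos_eq_iff[OF subgroup_bullet_Z_theta] line_limit_eq_iff
  by (simp add: orbit_map_def)

text \<open>
  The map induced by \<open>line_limit\<close> on the orbits of its kernel; on each orbit
  \<open>line_limit\<close> is constant, so the choice of the representative does not matter.
\<close>

definition orbit_limit :: "bullet set \<Rightarrow> real set \<times> real set" where
  "orbit_limit A = line_limit \<UU> \<theta> (SOME x. x \<in> carrier (bullet_reals \<UU>) \<and> orbit_map \<UU> \<theta> x = A)"

lemma orbit_limit_orbit_map:
  assumes "x \<in> carrier (bullet_reals \<UU>)"
  shows "orbit_limit (orbit_map \<UU> \<theta> x) = line_limit \<UU> \<theta> x"
proof -
  let ?y = "SOME y. y \<in> carrier (bullet_reals \<UU>) \<and> orbit_map \<UU> \<theta> y = orbit_map \<UU> \<theta> x"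
  have "?y \<in> carrier (bullet_reals \<UU>) \<and> orbit_map \<UU> \<theta> ?y = orbit_map \<UU> \<theta> x"
    by (rule someI[of _ x]) (simp add: assms)
  then show ?thesis
    using assms orbit_map_eq_iff by (auto simp only: orbit_limit_def)
qed

text \<open>
  Both leaves have their topology from a parametrization by the reals, and
  \<open>line_limit\<close> intertwines the two parametrizations.
\<close>

lemma quotient_map_line_limit_leaf:
  assumes x: "x \<in> carrier (bullet_reals \<UU>)"
  shows "quotient_map (bullet_leaf \<UU> x) (kronecker_leaf \<theta> (line_limit \<UU> \<theta> x)) (line_limit \<UU> \<theta>)"
proof -
  have "line_limit \<UU> \<theta> \<circ> (\<lambda>r. x \<otimes>\<^bsub>bullet_reals \<UU>\<^esub> of_standard \<UU> r)
      = (\<lambda>r. line_limit \<UU> \<theta> x \<otimes>\<^bsub>torus\<^esub> to_torus r (\<theta> * r))"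
    using x by (simp add: comp_def line_limit_of_standard mult.commute)
  then have "quotient_map euclideanreal (kronecker_leaf \<theta> (line_limit \<UU> \<theta> x))
      (line_limit \<UU> \<theta> \<circ> (\<lambda>r. x \<otimes>\<^bsub>bullet_reals \<UU>\<^esub> of_standard \<UU> r))"
    by (simp only: kronecker_leaf_def quotient_map_quotient_topology)
  then show ?thesis
    unfolding bullet_leaf_def by (simp only: quotient_map_compose_eq[OF quotient_map_quotient_topology])
qed

lemma homeomorphic_map_orbit_limit_leaf:
  assumes "x \<in> carrier (bullet_reals \<UU>)"
  shows "homeomorphic_map (quotient_topology (bullet_leaf \<UU> x) (orbit_map \<UU> \<theta>))
    (kronecker_leaf \<theta> (line_limit \<UU> \<theta> x)) orbit_limit"
  using topspace_bullet_leaf_subset[OF assms]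
  by (intro homeomorphic_map_quotient_topology[OF quotient_map_line_limit_leaf[OF assms]])
    (auto simp: orbit_limit_orbit_map orbit_map_eq_iff subset_iff)

end

context bullet_section
begin

text \<open>
  In the trivialization \<open>line_limit\<close> is the projection to the torus.
\<close>

lemma quotient_map_line_limit:
  "quotient_map (section_topology \<UU> \<theta> q \<sigma>) torus_topology (line_limit \<UU> \<theta>)"
proof -
  have ne: "bullet_Z_theta \<UU> \<theta> \<noteq> {}"
    using subgroup.one_closed[OF subgroup_bullet_Z_theta] by blast
  have "quotient_map sheets_topology torus_topology fst"
  proof (rule continuous_open_imp_quotient_map[OF continuous_map_fst open_map_fst])
    show "fst ` topspace sheets_topology = topspace torus_topology"
      using ne by (simp add: fst_image_times)
  qed
  then have "quotient_map sheets_topology torus_topology (line_limit \<UU> \<theta> \<circ> trivialization)"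
    by (rule quotient_map_eq) (auto simp: line_limit_trivialization)
  moreover have "quotient_map sheets_topology (section_topology \<UU> \<theta> q \<sigma>) trivialization"
    using homeomorphic_map_trivialization by (simp only: homeomorphic_map_def)
  ultimately show ?thesis by (simp only: quotient_map_compose_eq)
qed

lemma line_limit_image_bullet_Z_slope:
  "line_limit \<UU> \<theta> ` bullet_Z_slope \<UU> \<theta> q = torus_line q"
proof (intro equalityI subsetI)
  fix t assume "t \<in> torus_line q"
  then show "t \<in> line_limit \<UU> \<theta> ` bullet_Z_slope \<UU> \<theta> q"
    by (intro image_eqI[of _ _ "\<sigma> t"]) (simp_all add: line_limit_section section_in_bullet_Z_slope)
qed (auto simp: bullet_Z_slope_iff)

lemma foliation_iso_orbit_limit:
  "foliation_iso (quotient_of_bullet \<UU> \<theta> q \<sigma>) (kronecker \<theta> q) orbit_limit"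
  unfolding foliation_iso_def quotient_of_bullet_def quotient_transversed_def bullet_foliation_def
    kronecker_def transversed.simps foliated.simps
proof (intro conjI)
  show "homeomorphic_map (quotient_topology (section_topology \<UU> \<theta> q \<sigma>) (orbit_map \<UU> \<theta>))
      torus_topology orbit_limit"
    by (rule homeomorphic_map_quotient_topology[OF quotient_map_line_limit])
      (simp_all add: orbit_limit_orbit_map orbit_map_eq_iff)
  show "\<forall>L\<in>(\<lambda>L. quotient_topology L (orbit_map \<UU> \<theta>)) ` bullet_leaves \<UU>.
      \<exists>M\<in>kronecker_leaf \<theta> ` carrier torus. homeomorphic_map L M orbit_limit"
    using homeomorphic_map_orbit_limit_leaf limit.hom_closed unfolding bullet_leaves_def by blast
  show "\<forall>M\<in>kronecker_leaf \<theta> ` carrier torus.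
      \<exists>L\<in>(\<lambda>L. quotient_topology L (orbit_map \<UU> \<theta>)) ` bullet_leaves \<UU>. homeomorphic_map L M orbit_limit"
  proof
    fix M assume "M \<in> kronecker_leaf \<theta> ` carrier torus"
    then obtain u where u: "u \<in> carrier torus" "M = kronecker_leaf \<theta> u" by blast
    have "homeomorphic_map (quotient_topology (bullet_leaf \<UU> (global_section u)) (orbit_map \<UU> \<theta>)) M orbit_limit"
      using homeomorphic_map_orbit_limit_leaf[OF global_section_carrier[OF u(1)]] u
      by (simp add: line_limit_global_section)
    then show "\<exists>L\<in>(\<lambda>L. quotient_topology L (orbit_map \<UU> \<theta>)) ` bullet_leaves \<UU>. homeomorphic_map L M orbit_limit"
      using global_section_carrier[OF u(1)] unfolding bullet_leaves_def by blast
  qed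
  show "homeomorphic_map (quotient_topology (bullet_leaf \<UU> \<one>\<^bsub>bullet_reals \<UU>\<^esub>) (orbit_map \<UU> \<theta>))
      (kronecker_leaf \<theta> \<one>\<^bsub>torus\<^esub>) orbit_limit"
    using homeomorphic_map_orbit_limit_leaf[OF bullet.one_closed] by simp
  have "orbit_limit ` orbit_map \<UU> \<theta> ` bullet_Z_slope \<UU> \<theta> q = line_limit \<UU> \<theta> ` bullet_Z_slope \<UU> \<theta> q"
    unfolding image_image by (rule image_cong) (simp_all add: orbit_limit_orbit_map bullet_Z_slope_iff)
  then show "orbit_limit ` orbit_map \<UU> \<theta> ` bullet_Z_slope \<UU> \<theta> q = torus_line q"
    by (simp only: line_limit_image_bullet_Z_slope)
qed

end

section \<open>Transport of foliations along isomorphisms\<close>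

lemma homeomorphic_map_mem_iff:
  assumes f: "inj_on f A" "topspace L \<subseteq> A" and L: "homeomorphic_map L M f" and x: "x \<in> A"
  shows "x \<in> topspace L \<longleftrightarrow> f x \<in> topspace M"
  using inj_on_image_mem_iff[OF f(1) x f(2)] homeomorphic_imp_surjective_map[OF L] by simp

lemma foliated_chart_pullback:
  assumes f: "homeomorphic_map (fol_space F) (fol_space G) f"
    and leaves: "\<And>L. L \<in> fol_leaves F \<Longrightarrow> topspace L \<subseteq> topspace (fol_space F)"
    and ex: "\<And>M. M \<in> fol_leaves G \<Longrightarrow> \<exists>L\<in>fol_leaves F. homeomorphic_map L M f"
    and chart: "foliated_chart G U V W \<phi>"
  shows "foliated_chart F {x \<in> topspace (fol_space F). f x \<in> U} V W (\<phi> \<circ> f)"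
proof -
  let ?U = "{x \<in> topspace (fol_space F). f x \<in> U}"
  have U: "openin (fol_space G) U" and VW: "open V" "is_interval V" "open W"
    and \<phi>: "homeomorphic_map (subtopology (fol_space G) U) (top_of_set (V \<times> W)) \<phi>"
    and plaques: "\<And>w. w \<in> W \<Longrightarrow> \<exists>M\<in>fol_leaves G. openin M {x \<in> U. snd (\<phi> x) = w} \<and>
        homeomorphic_map (subtopology M {x \<in> U. snd (\<phi> x) = w}) (top_of_set (V \<times> {w})) \<phi>"
    using chart by (auto simp: foliated_chart_def)
  have inj: "inj_on f (topspace (fol_space F))"
    by (rule homeomorphic_imp_injective_map[OF f])
  have "openin (fol_space F) ?U"
    using homeomorphic_imp_continuous_map[OF f] U by (rule openin_continuous_map_preimage)
  moreover have "homeomorphic_map (subtopology (fol_space F) ?U) (top_of_set (V \<times> W)) (\<phi> \<circ> f)"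
    by (rule homeomorphic_map_compose[OF homeomorphic_map_subtopologies_alt[OF f] \<phi>]) auto
  moreover have "\<exists>L\<in>fol_leaves F. openin L {x \<in> ?U. snd ((\<phi> \<circ> f) x) = w} \<and>
      homeomorphic_map (subtopology L {x \<in> ?U. snd ((\<phi> \<circ> f) x) = w}) (top_of_set (V \<times> {w})) (\<phi> \<circ> f)"
    if "w \<in> W" for w
  proof -
    let ?P = "{x \<in> U. snd (\<phi> x) = w}" and ?P' = "{x \<in> ?U. snd ((\<phi> \<circ> f) x) = w}"
    from plaques[OF that] obtain M where M: "M \<in> fol_leaves G" "openin M ?P"
      "homeomorphic_map (subtopology M ?P) (top_of_set (V \<times> {w})) \<phi>" by blast
    from ex[OF M(1)] obtain L where L: "L \<in> fol_leaves F" "homeomorphic_map L M f" by blast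
    have eq: "?P' = {x \<in> topspace L. f x \<in> ?P}"
      using homeomorphic_map_mem_iff[OF inj leaves[OF L(1)] L(2)] leaves[OF L(1)]
        openin_subset[OF M(2)] by fastforce
    have "openin L ?P'"
      unfolding eq using homeomorphic_imp_continuous_map[OF L(2)] M(2)
      by (rule openin_continuous_map_preimage)
    moreover have "homeomorphic_map (subtopology L ?P') (top_of_set (V \<times> {w})) (\<phi> \<circ> f)"
      unfolding eq
      by (rule homeomorphic_map_compose[OF homeomorphic_map_subtopologies_alt[OF L(2)] M(3)]) auto
    ultimately show ?thesis using L(1) by blast
  qed
  ultimately show ?thesis using VW by (simp add: foliated_chart_def)
qed

text \<open>
  Neither the leaves nor the transversal are required by \<open>foliation_iso\<close> to lie in the
  total space, nor the distinguished leaf to be a leaf, so these conditions on \<open>F\<close> are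
  separate hypotheses.
\<close>

lemma foliation_with_transversal_pullback:
  assumes iso: "foliation_iso F G f" and G: "foliation_with_transversal G"
    and leaves: "\<And>L. L \<in> fol_leaves F \<Longrightarrow> topspace L \<subseteq> topspace (fol_space F)"
    and dist: "dist_leaf F \<in> fol_leaves F"
    and trans: "dist_transversal F \<subseteq> topspace (fol_space F)"
  shows "foliation_with_transversal F"
proof -
  have f: "homeomorphic_map (fol_space F) (fol_space G) f"
    and to: "\<And>L. L \<in> fol_leaves F \<Longrightarrow> \<exists>M\<in>fol_leaves G. homeomorphic_map L M f"
    and from': "\<And>M. M \<in> fol_leaves G \<Longrightarrow> \<exists>L\<in>fol_leaves F. homeomorphic_map L M f"
    and T: "f ` dist_transversal F = dist_transversal G"
    using iso by (auto simp: foliation_iso_def)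
  have GH: "Hausdorff_space (fol_space G)"
    and GU: "(\<Union>L\<in>fol_leaves G. topspace L) = topspace (fol_space G)"
    and GC: "\<And>L. L \<in> fol_leaves G \<Longrightarrow> connected_space L \<and> topspace L \<noteq> {}"
    and GD: "\<And>L M. L \<in> fol_leaves G \<Longrightarrow> M \<in> fol_leaves G \<Longrightarrow> L \<noteq> M \<Longrightarrow> topspace L \<inter> topspace M = {}"
    and GA: "\<And>x. x \<in> topspace (fol_space G) \<Longrightarrow> \<exists>U V W \<phi>. x \<in> U \<and> foliated_chart G U V W \<phi>"
    and GT: "transversal G (dist_transversal G)"
    using G by (simp_all add: foliation_with_transversal_def foliation_def)
  have inj: "inj_on f (topspace (fol_space F))"
    by (rule homeomorphic_imp_injective_map[OF f])
  have surj: "f ` topspace (fol_space F) = topspace (fol_space G)"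
    by (rule homeomorphic_imp_surjective_map[OF f])
  note mem = homeomorphic_map_mem_iff[OF inj leaves]
  have pull: "foliated_chart F {x \<in> topspace (fol_space F). f x \<in> U} V W (\<phi> \<circ> f)"
    if "foliated_chart G U V W \<phi>" for U V W \<phi>
    by (rule foliated_chart_pullback[OF f _ _ that]) (erule leaves, erule from')
  have "Hausdorff_space (fol_space F)"
    using homeomorphic_Hausdorff_space[OF homeomorphic_map_imp_homeomorphic_space[OF f]] GH by blast
  moreover have "(\<Union>L\<in>fol_leaves F. topspace L) = topspace (fol_space F)"
  proof (intro equalityI subsetI)
    fix x assume x: "x \<in> topspace (fol_space F)"
    then have "f x \<in> topspace (fol_space G)" using surj by blast
    then obtain M where M: "M \<in> fol_leaves G" "f x \<in> topspace M" using GU by blast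
    from from'[OF M(1)] obtain L where L: "L \<in> fol_leaves F" "homeomorphic_map L M f" by blast
    with mem[OF L x] M(2) show "x \<in> (\<Union>L\<in>fol_leaves F. topspace L)" by blast
  qed (use leaves in blast)
  moreover have "connected_space L \<and> topspace L \<noteq> {}" if L: "L \<in> fol_leaves F" for L
  proof -
    from to[OF L] obtain M where M: "M \<in> fol_leaves G" "homeomorphic_map L M f" by blast
    have "connected_space L"
      using GC[OF M(1)] homeomorphic_connected_space[OF homeomorphic_map_imp_homeomorphic_space[OF M(2)]]
      by blast
    moreover have "topspace L \<noteq> {}"
      using conjunct2[OF GC[OF M(1)]] homeomorphic_imp_surjective_map[OF M(2)] by blast
    ultimately show ?thesis ..
  qed
  moreover have "topspace L \<inter> topspace L' = {}"
    if L: "L \<in> fol_leaves F" and L': "L' \<in> fol_leaves F" and ne: "L \<noteq> L'" for L L'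
  proof (rule ccontr)
    assume "topspace L \<inter> topspace L' \<noteq> {}"
    then obtain x where x: "x \<in> topspace L" "x \<in> topspace L'" by blast
    from to[OF L] obtain M where M: "M \<in> fol_leaves G" "homeomorphic_map L M f" by blast
    from to[OF L'] obtain M' where M': "M' \<in> fol_leaves G" "homeomorphic_map L' M' f" by blast
    have "f x \<in> topspace M" "f x \<in> topspace M'"
      using x homeomorphic_imp_surjective_map[OF M(2)] homeomorphic_imp_surjective_map[OF M'(2)] by blast+
    then have eq: "M' = M" using GD[OF M(1) M'(1)] by blast
    have top: "topspace L = topspace L'"
      using mem[OF L M(2)] mem[OF L' M'(2)] leaves[OF L] leaves[OF L'] unfolding eq by blast
    have "openin L S \<longleftrightarrow> openin L' S" for S
      using homeomorphic_map_openness_eq[OF M(2)] homeomorphic_map_openness_eq[OF M'(2)]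
      by (simp add: top eq)
    then have "L = L'" by (simp add: topology_eq)
    with ne show False by contradiction
  qed
  moreover have "\<exists>U V W \<phi>. x \<in> U \<and> foliated_chart F U V W \<phi>"
    if x: "x \<in> topspace (fol_space F)" for x
  proof -
    have "f x \<in> topspace (fol_space G)" using x surj by blast
    then obtain U V W \<phi> where U: "f x \<in> U" "foliated_chart G U V W \<phi>" using GA by blast
    have "x \<in> {x \<in> topspace (fol_space F). f x \<in> U}" using x U(1) by simp
    with pull[OF U(2)] show ?thesis by (intro exI conjI)
  qed
  moreover have "transversal F (dist_transversal F)"
    unfolding transversal_def
  proof (intro conjI trans ballI)
    fix x assume x: "x \<in> dist_transversal F"
    then have "f x \<in> dist_transversal G" using T by blast
    then obtain U V W \<phi> v where U: "f x \<in> U" "foliated_chart G U V W \<phi>" "v \<in> V"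
      "dist_transversal G \<inter> U = {y \<in> U. fst (\<phi> y) = v}"
      using GT unfolding transversal_def by blast
    let ?U = "{x \<in> topspace (fol_space F). f x \<in> U}"
    have "y \<in> dist_transversal F \<longleftrightarrow> f y \<in> dist_transversal G" if "y \<in> topspace (fol_space F)" for y
      using inj_on_image_mem_iff[OF inj that trans] by (simp add: T)
    then have "dist_transversal F \<inter> ?U = {y \<in> ?U. fst ((\<phi> \<circ> f) y) = v}"
      using U(4) by auto
    moreover have "x \<in> ?U" using x trans U(1) by blast
    ultimately show "\<exists>U V W \<phi> v. x \<in> U \<and> foliated_chart F U V W \<phi> \<and> v \<in> V \<and>
        dist_transversal F \<inter> U = {y \<in> U. fst (\<phi> y) = v}"
      using pull[OF U(2)] U(3) by (intro exI conjI)
  qed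
  ultimately show ?thesis
    using dist unfolding foliation_with_transversal_def foliation_def by blast
qed


section \<open>Charts of the Kronecker foliation\<close>

lemma quotient_topology_unique: "quotient_map X Y f \<Longrightarrow> quotient_topology X f = Y"
  unfolding topology_eq openin_quotient_topology quotient_map_def by (metis openin_subset)

context
  fixes \<theta> :: real
  assumes irrational: "\<theta> \<notin> \<rat>"
begin

text \<open>
  Since \<open>\<theta>\<close> is irrational, no leaf closes up.
\<close>

lemma homeomorphic_map_kronecker_leaf:
  assumes t: "t \<in> carrier torus"
  shows "homeomorphic_map euclideanreal (kronecker_leaf \<theta> t) (\<lambda>r. t \<otimes>\<^bsub>torus\<^esub> to_torus r (\<theta> * r))"
  unfolding homeomorphic_map_def kronecker_leaf_def
proof (intro conjI quotient_map_quotient_topology)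
  from t obtain x y where t: "t = to_torus x y" by (rule carrier_torusE)
  show "inj_on (\<lambda>r. t \<otimes>\<^bsub>torus\<^esub> to_torus r (\<theta> * r)) (topspace euclideanreal)"
  proof (rule inj_onI, rule ccontr)
    fix r s assume eq: "t \<otimes>\<^bsub>torus\<^esub> to_torus r (\<theta> * r) = t \<otimes>\<^bsub>torus\<^esub> to_torus s (\<theta> * s)" and ne: "r \<noteq> s"
    then have "r - s \<in> \<rat>" "\<theta> * (r - s) \<in> \<rat>"
      using Ints_subset_Rats by (auto simp: t to_torus_eq_iff algebra_simps)
    then have "\<theta> * (r - s) / (r - s) \<in> \<rat>" by (intro Rats_divide)
    then show False using irrational ne by simp
  qed
qed

lemma kronecker_leaf_translate:
  assumes t: "t \<in> carrier torus"
  shows "kronecker_leaf \<theta> (t \<otimes>\<^bsub>torus\<^esub> to_torus c (\<theta> * c)) = kronecker_leaf \<theta> t"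
proof -
  from t obtain x y where t': "t = to_torus x y" by (rule carrier_torusE)
  have "homeomorphic_maps euclideanreal euclideanreal (\<lambda>r. c + r) (\<lambda>r. r - c)"
    by (simp add: homeomorphic_maps_def continuous_intros)
  then have "homeomorphic_map euclideanreal (kronecker_leaf \<theta> t)
      ((\<lambda>r. t \<otimes>\<^bsub>torus\<^esub> to_torus r (\<theta> * r)) \<circ> (\<lambda>r. c + r))"
    by (intro homeomorphic_map_compose[OF _ homeomorphic_map_kronecker_leaf[OF t]])
      (rule homeomorphic_maps_imp_map)
  moreover have "(\<lambda>r. t \<otimes>\<^bsub>torus\<^esub> to_torus r (\<theta> * r)) \<circ> (\<lambda>r. c + r)
      = (\<lambda>r. t \<otimes>\<^bsub>torus\<^esub> to_torus c (\<theta> * c) \<otimes>\<^bsub>torus\<^esub> to_torus r (\<theta> * r))"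
    by (simp add: t' comp_def algebra_simps)
  ultimately show ?thesis
    unfolding homeomorphic_map_def
    by (simp only: kronecker_leaf_def[of \<theta> "t \<otimes>\<^bsub>torus\<^esub> to_torus c (\<theta> * c)"] quotient_topology_unique)
qed

lemma kronecker_leaf_eqI:
  assumes "t \<in> carrier torus" "t' \<in> carrier torus"
    "topspace (kronecker_leaf \<theta> t) \<inter> topspace (kronecker_leaf \<theta> t') \<noteq> {}"
  shows "kronecker_leaf \<theta> t = kronecker_leaf \<theta> t'"
proof -
  from assms(3) obtain z where z: "z \<in> topspace (kronecker_leaf \<theta> t)" "z \<in> topspace (kronecker_leaf \<theta> t')"
    by blast
  then obtain r s where "z = t \<otimes>\<^bsub>torus\<^esub> to_torus r (\<theta> * r)" "z = t' \<otimes>\<^bsub>torus\<^esub> to_torus s (\<theta> * s)"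
    unfolding kronecker_leaf_def topspace_quotient_topology by (elim imageE)
  then show ?thesis
    using kronecker_leaf_translate[OF assms(1), of r] kronecker_leaf_translate[OF assms(2), of s] by simp
qed

text \<open>
  Near \<open>x\<close> a point of the torus is \<open>x + v * (1, \<theta>) + w * (run q, rise q)\<close> for
  unique small \<open>v\<close> and \<open>w\<close>, and these are the chart coordinates: \<open>v\<close> runs
  along the leaf through the point with \<open>v = 0\<close>, which is why a plaque is the image of an
  interval under the parametrization of a leaf.  If \<open>x\<close> lies on the line of slope
  \<open>q\<close>, then so do the points with \<open>v = 0\<close>, and no other small \<open>v\<close> gives a point
  of the line because the lattice of the slope is discrete.
\<close>

lemma kronecker_chart_exists:
  assumes x: "x \<in> carrier torus"
  obtains U V \<phi> where "x \<in> U" "foliated_chart (kronecker \<theta> q) U V V \<phi>" "0 \<in> V"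
    "x \<in> torus_line q \<Longrightarrow> torus_line q \<inter> U = {y \<in> U. fst (\<phi> y) = 0}"
proof -
  from x obtain a b where x: "x = to_torus a b" by (rule carrier_torusE)
  let ?g = "\<lambda>p. torus_cover ((a, b) + line_coordinates \<theta> q p)"
  have g: "?g (v, w) = x \<otimes>\<^bsub>torus\<^esub> to_torus (v + w * run q) (v * \<theta> + w * rise q)" for v w
    by (simp add: x line_coordinates_def)
  obtain c where c: "c > 0"
    "\<And>k l. k \<in> slope_lattice q \<Longrightarrow> l \<in> slope_lattice q \<Longrightarrow> \<bar>k - l\<bar> < c \<Longrightarrow> k = l"
    using slope_lattice_uniformly_discrete[of q] by metis
  let ?C = "1 + \<bar>\<theta>\<bar> + \<bar>run q\<bar> + \<bar>rise q\<bar>"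
  have det: "slope_det \<theta> q \<noteq> 0" by (rule slope_det_nonzero[OF irrational])
  \<comment> \<open>the first bound makes the chart injective, the second one keeps the other branches of the line of slope \<open>q\<close> away\<close>
  define \<delta> where "\<delta> = min (1 / (2 * ?C)) (c / \<bar>slope_det \<theta> q\<bar>)"
  have \<delta>: "\<delta> > 0" "2 * \<delta> * ?C \<le> 1" "\<delta> * \<bar>slope_det \<theta> q\<bar> \<le> c"
  proof -
    show "\<delta> > 0" using c(1) det by (auto simp: \<delta>_def)
    have "\<delta> \<le> 1 / (2 * ?C)" "\<delta> \<le> c / \<bar>slope_det \<theta> q\<bar>" by (simp_all add: \<delta>_def)
    moreover have "0 < 2 * ?C" "0 < \<bar>slope_det \<theta> q\<bar>"
      using det by (simp_all add: add_pos_nonneg)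
    ultimately have "\<delta> * (2 * ?C) \<le> 1" "\<delta> * \<bar>slope_det \<theta> q\<bar> \<le> c"
      by (simp_all only: pos_le_divide_eq)
    then show "2 * \<delta> * ?C \<le> 1" "\<delta> * \<bar>slope_det \<theta> q\<bar> \<le> c"
      by (simp_all only: mult.assoc mult.left_commute[of \<delta> 2])
  qed
  define V where "V = {-\<delta><..<\<delta>}"
  have V: "open V" "is_interval V" "0 \<in> V" using \<delta>(1) by (auto simp: V_def is_interval_oo)
  \<comment> \<open>this applies to the differences of the plane coordinates of two points of the chart\<close>
  have small: "i = 0" if "i \<in> \<int>" "i = s * \<alpha> + t * \<beta>" "\<bar>s\<bar> < 2 * \<delta>" "\<bar>t\<bar> < 2 * \<delta>" "\<bar>\<alpha>\<bar> + \<bar>\<beta>\<bar> \<le> ?C"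
    for i s t \<alpha> \<beta>
  proof -
    have "\<bar>i\<bar> \<le> \<bar>s\<bar> * \<bar>\<alpha>\<bar> + \<bar>t\<bar> * \<bar>\<beta>\<bar>"
      unfolding that(2) by (metis abs_mult abs_triangle_ineq)
    show "i = 0"
    proof (cases "\<alpha> = 0 \<and> \<beta> = 0")
      case False
      have "\<bar>s\<bar> * \<bar>\<alpha>\<bar> + \<bar>t\<bar> * \<bar>\<beta>\<bar> < 2 * \<delta> * (\<bar>\<alpha>\<bar> + \<bar>\<beta>\<bar>)"
      proof (cases "\<alpha> = 0")
        case True
        then show ?thesis using False that(4) by simp
      next
        case a: False
        have "\<bar>s\<bar> * \<bar>\<alpha>\<bar> < 2 * \<delta> * \<bar>\<alpha>\<bar>" using that(3) a by simp
        moreover have "\<bar>t\<bar> * \<bar>\<beta>\<bar> \<le> 2 * \<delta> * \<bar>\<beta>\<bar>" using that(4) by (simp add: mult_right_mono)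
        ultimately show ?thesis by (simp only: distrib_left)
      qed
      also have "\<dots> \<le> 2 * \<delta> * ?C" using that(5) \<delta>(1) by (intro mult_left_mono) auto
      finally have "\<bar>i\<bar> < 1" using \<open>\<bar>i\<bar> \<le> _\<close> \<delta>(2) by linarith
      with that(1) show ?thesis by (rule Ints_nonzero_abs_less1)
    qed (use that(2) in simp)
  qed
  have inj: "inj_on ?g (V \<times> V)"
  proof (rule inj_onI, clarify)
    fix v w v' w' assume mem: "v \<in> V" "w \<in> V" "v' \<in> V" "w' \<in> V" and eq: "?g (v, w) = ?g (v', w')"
    have s: "\<bar>v - v'\<bar> < 2 * \<delta>" "\<bar>w - w'\<bar> < 2 * \<delta>" using mem by (auto simp: V_def)
    have "(v + w * run q) - (v' + w' * run q) \<in> \<int>" "(v * \<theta> + w * rise q) - (v' * \<theta> + w' * rise q) \<in> \<int>"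
      using eq by (simp_all add: line_coordinates_def to_torus_eq_iff)
    moreover have "(v + w * run q) - (v' + w' * run q) = (v - v') * 1 + (w - w') * run q"
      "(v * \<theta> + w * rise q) - (v' * \<theta> + w' * rise q) = (v - v') * \<theta> + (w - w') * rise q"
      by (simp_all add: algebra_simps)
    ultimately have "(v + w * run q) - (v' + w' * run q) = 0" "(v * \<theta> + w * rise q) - (v' * \<theta> + w' * rise q) = 0"
      using small[OF _ _ s, of _ 1 "run q"] small[OF _ _ s, of _ \<theta> "rise q"] by auto
    then have "line_coordinates \<theta> q (v, w) = line_coordinates \<theta> q (v', w')"
      by (simp add: line_coordinates_def)
    then have "(v, w) = (v', w')"
      using homeomorphic_imp_injective_map[OF homeomorphic_map_line_coordinates[OF irrational]]
      by (simp add: inj_eq)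
    then show "v = v' \<and> w = w'" by simp
  qed
  have translate: "homeomorphic_map euclidean euclidean (\<lambda>p :: real \<times> real. (a, b) + p)"
    by (rule homeomorphic_maps_imp_map[of _ _ _ "\<lambda>p. p - (a, b)"])
      (simp add: homeomorphic_maps_def continuous_intros del: split_paired_All)
  have affine: "homeomorphic_map euclidean euclidean ((\<lambda>p. (a, b) + p) \<circ> line_coordinates \<theta> q)"
    by (rule homeomorphic_map_compose[OF homeomorphic_map_line_coordinates[OF irrational] translate])
  have cont: "continuous_map euclidean torus_topology ?g"
    using continuous_map_compose[OF homeomorphic_imp_continuous_map[OF affine] continuous_map_torus_cover]
    by (simp add: comp_def)
  have open': "open_map euclidean torus_topology ?g"
    using open_map_compose[OF homeomorphic_imp_open_map[OF affine] open_map_torus_cover]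
    by (simp add: comp_def)
  define U where "U = ?g ` (V \<times> V)"
  have openU: "openin torus_topology U"
    using open' V(1) by (auto simp: open_map_def U_def open_Times)
  have Utop: "topspace (subtopology torus_topology U) = U"
    using openin_subset[OF openU] by auto
  have "homeomorphic_map (top_of_set (V \<times> V)) (subtopology torus_topology U) ?g"
  proof (rule bijective_open_imp_homeomorphic_map)
    show "continuous_map (top_of_set (V \<times> V)) (subtopology torus_topology U) ?g"
      using cont by (auto simp: continuous_map_in_subtopology continuous_map_from_subtopology U_def)
    have "open_map (top_of_set (V \<times> V)) torus_topology ?g"
      using open' V(1) by (intro open_map_from_subtopology) (simp_all add: open_Times)
    then show "open_map (top_of_set (V \<times> V)) (subtopology torus_topology U) ?g"
      by (rule open_map_into_subtopology) (simp add: U_def)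
    show "?g ` topspace (top_of_set (V \<times> V)) = topspace (subtopology torus_topology U)"
      by (simp only: Utop) (simp add: U_def)
    show "inj_on ?g (topspace (top_of_set (V \<times> V)))" using inj by simp
  qed
  then obtain \<phi> where maps: "homeomorphic_maps (top_of_set (V \<times> V)) (subtopology torus_topology U) ?g \<phi>"
    unfolding homeomorphic_map_maps by blast
  then have \<phi>: "homeomorphic_map (subtopology torus_topology U) (top_of_set (V \<times> V)) \<phi>"
    and \<phi>g: "\<And>v w. v \<in> V \<Longrightarrow> w \<in> V \<Longrightarrow> \<phi> (?g (v, w)) = (v, w)"
    unfolding homeomorphic_maps_map by simp_all
  have plaque: "{y \<in> U. snd (\<phi> y) = w} = (\<lambda>v. ?g (v, w)) ` V" if "w \<in> V" for w
    using that \<phi>g by (fastforce simp: U_def)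
  have "foliated_chart (kronecker \<theta> q) U V V \<phi>"
    unfolding foliated_chart_def kronecker_def transversed.simps foliated.simps
  proof (intro conjI openU V \<phi> ballI)
    fix w assume w: "w \<in> V"
    let ?t = "x \<otimes>\<^bsub>torus\<^esub> to_torus (w * run q) (w * rise q)"
    let ?l = "\<lambda>r. ?t \<otimes>\<^bsub>torus\<^esub> to_torus r (\<theta> * r)" and ?L = "kronecker_leaf \<theta> ?t"
    let ?P = "{y \<in> U. snd (\<phi> y) = w}"
    have t: "?t \<in> carrier torus" by (simp add: x)
    have gl: "?g (v, w) = ?l v" for v
      by (simp only: g) (simp add: x algebra_simps)
    have P: "?P = ?l ` V" by (simp only: plaque[OF w] gl)
    have l: "homeomorphic_map euclideanreal ?L ?l" by (rule homeomorphic_map_kronecker_leaf[OF t])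
    have openP: "openin ?L ?P"
      unfolding P using homeomorphic_imp_open_map[OF l] V(1) by (simp add: open_map_def)
    have lV: "homeomorphic_map (top_of_set V) (subtopology ?L ?P) ?l"
      by (rule homeomorphic_map_subtopologies[OF l])
        (use openin_subset[OF openP] in \<open>auto simp: P\<close>)
    have "homeomorphic_map (top_of_set V) (top_of_set (V \<times> {w})) (\<lambda>v. (v, w))"
    proof (rule homeomorphic_maps_imp_map)
      show "homeomorphic_maps (top_of_set V) (top_of_set (V \<times> {w})) (\<lambda>v. (v, w)) fst"
        unfolding homeomorphic_maps_def by (auto intro!: continuous_intros)
    qed
    then have \<phi>l: "homeomorphic_map (top_of_set V) (top_of_set (V \<times> {w})) (\<phi> \<circ> ?l)"
      by (rule homeomorphic_map_eq) (simp add: gl[symmetric] \<phi>g w del: torus_cover_simp)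
    have lq: "quotient_map (top_of_set V) (subtopology ?L ?P) ?l"
      using lV unfolding homeomorphic_map_def by (rule conjunct1)
    have "quotient_map (subtopology ?L ?P) (top_of_set (V \<times> {w})) \<phi>"
      using \<phi>l unfolding homeomorphic_map_def quotient_map_compose_eq[OF lq] by (rule conjunct1)
    moreover have "inj_on \<phi> (topspace (subtopology ?L ?P))"
      by (rule inj_on_subset[OF homeomorphic_imp_injective_map[OF \<phi>]]) (use Utop in auto)
    ultimately have "homeomorphic_map (subtopology ?L ?P) (top_of_set (V \<times> {w})) \<phi>"
      by (simp only: homeomorphic_map_def)
    then show "\<exists>L\<in>kronecker_leaf \<theta> ` carrier torus. openin L ?P \<and>
        homeomorphic_map (subtopology L ?P) (top_of_set (V \<times> {w})) \<phi>"
      by (intro bexI[of _ ?L] conjI openP imageI t)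
  qed
  moreover have "x \<in> U"
    using V(3) by (auto simp: U_def x line_coordinates_def intro!: image_eqI[of _ _ "(0, 0)"])
  moreover have "torus_line q \<inter> U = {y \<in> U. fst (\<phi> y) = 0}" if line: "x \<in> torus_line q"
  proof -
    have "?g (v, w) \<in> torus_line q \<longleftrightarrow> v = 0" if v: "v \<in> V" for v w
    proof -
      have 1: "run q * b - rise q * a \<in> slope_lattice q"
        using line by (simp add: x to_torus_in_line_iff)
      have "run q * (b + (v * \<theta> + w * rise q)) - rise q * (a + (v + w * run q))
          = v * slope_det \<theta> q + (run q * b - rise q * a)"
        by (simp add: slope_det_def algebra_simps)
      then have "?g (v, w) \<in> torus_line q \<longleftrightarrow> v * slope_det \<theta> q + (run q * b - rise q * a) \<in> slope_lattice q"
        by (simp add: line_coordinates_def to_torus_in_line_iff)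
      also have "\<dots> \<longleftrightarrow> v = 0"
      proof
        assume "v * slope_det \<theta> q + (run q * b - rise q * a) \<in> slope_lattice q"
        moreover have "\<bar>v * slope_det \<theta> q\<bar> < c"
        proof -
          have "\<bar>v\<bar> * \<bar>slope_det \<theta> q\<bar> < \<delta> * \<bar>slope_det \<theta> q\<bar>"
            using v det by (auto simp: V_def)
          with \<delta>(3) show ?thesis by (simp add: abs_mult)
        qed
        ultimately have "v * slope_det \<theta> q + (run q * b - rise q * a) = run q * b - rise q * a"
          by (intro c(2)[OF _ 1]) simp_all
        then show "v = 0" using det by simp
      qed (use 1 in simp)
      finally show ?thesis .
    qed
    then show ?thesis using \<phi>g by (fastforce simp: U_def)
  qed
  ultimately show ?thesis using that V(3) by blast
qed

theorem foliation_with_transversal_kronecker: "foliation_with_transversal (kronecker \<theta> q)"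
proof -
  have leaf_top: "topspace (kronecker_leaf \<theta> t) \<subseteq> carrier torus" if "t \<in> carrier torus" for t
    using that unfolding kronecker_leaf_def topspace_quotient_topology
    by (intro image_subsetI) (auto elim!: carrier_torusE)
  have leaf_self: "t \<in> topspace (kronecker_leaf \<theta> t)" if "t \<in> carrier torus" for t
    using that
    by (auto simp: kronecker_leaf_def topspace_quotient_topology carrier_torus intro!: image_eqI[of _ _ 0])
  have "foliation (kronecker \<theta> q)"
    unfolding foliation_def
  proof (intro conjI ballI impI)
    show "Hausdorff_space (fol_space (kronecker \<theta> q))"
      by (simp add: kronecker_def Hausdorff_torus)
    show "(\<Union>L\<in>fol_leaves (kronecker \<theta> q). topspace L) = topspace (fol_space (kronecker \<theta> q))"
      using leaf_top leaf_self by (auto simp: kronecker_def)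
  next
    fix L assume "L \<in> fol_leaves (kronecker \<theta> q)"
    then obtain t where t: "t \<in> carrier torus" "L = kronecker_leaf \<theta> t"
      by (auto simp: kronecker_def)
    have "connected_space euclideanreal" using connectedin_topspace[of euclideanreal] by simp
    then show "connected_space L"
      using homeomorphic_connected_space[OF homeomorphic_map_imp_homeomorphic_space[OF homeomorphic_map_kronecker_leaf[OF t(1)]]]
      by (simp add: t(2))
    show "topspace L \<noteq> {}" using leaf_self t by blast
  next
    fix L M assume LM: "L \<in> fol_leaves (kronecker \<theta> q)" "M \<in> fol_leaves (kronecker \<theta> q)" "L \<noteq> M"
    then obtain s t where "s \<in> carrier torus" "t \<in> carrier torus"
      "L = kronecker_leaf \<theta> s" "M = kronecker_leaf \<theta> t"
      by (auto simp: kronecker_def)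
    with LM(3) kronecker_leaf_eqI[of s t] show "topspace L \<inter> topspace M = {}"
      by blast
  next
    fix x assume "x \<in> topspace (fol_space (kronecker \<theta> q))"
    then have "x \<in> carrier torus" by (simp add: kronecker_def)
    then show "\<exists>U V W \<phi>. x \<in> U \<and> foliated_chart (kronecker \<theta> q) U V W \<phi>"
      by (rule kronecker_chart_exists[of x q]) blast
  qed
  moreover have "transversal (kronecker \<theta> q) (torus_line q)"
    unfolding transversal_def
  proof (intro conjI ballI)
    show "torus_line q \<subseteq> topspace (fol_space (kronecker \<theta> q))"
      using torus_line_subset by (simp add: kronecker_def)
    fix x assume x: "x \<in> torus_line q"
    then have "x \<in> carrier torus" using torus_line_subset by blast
    then show "\<exists>U V W \<phi> v. x \<in> U \<and> foliated_chart (kronecker \<theta> q) U V W \<phi> \<and> v \<in> V \<and>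
        torus_line q \<inter> U = {y \<in> U. fst (\<phi> y) = v}"
      by (rule kronecker_chart_exists[of x q]) (use x in blast)
  qed
  ultimately show ?thesis
    by (simp add: foliation_with_transversal_def)
      (simp add: kronecker_def one_torus)
qed

end

lemma (in bullet_section) foliation_with_transversal_quotient:
  "foliation_with_transversal (quotient_of_bullet \<UU> \<theta> q \<sigma>)"
proof (rule foliation_with_transversal_pullback[OF foliation_iso_orbit_limit])
  show "foliation_with_transversal (kronecker \<theta> q)"
    by (rule foliation_with_transversal_kronecker[OF irrational])
next
  fix L assume "L \<in> fol_leaves (quotient_of_bullet \<UU> \<theta> q \<sigma>)"
  then obtain x where x: "x \<in> carrier (bullet_reals \<UU>)"
    "L = quotient_topology (bullet_leaf \<UU> x) (orbit_map \<UU> \<theta>)"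
    by (auto simp: quotient_of_bullet_def quotient_transversed_def bullet_foliation_def bullet_leaves_def)
  show "topspace L \<subseteq> topspace (fol_space (quotient_of_bullet \<UU> \<theta> q \<sigma>))"
    using image_mono[OF topspace_bullet_leaf_subset[OF x(1)]]
    by (simp add: x(2) quotient_of_bullet_def quotient_transversed_def bullet_foliation_def
        topspace_quotient_topology)
next
  show "dist_leaf (quotient_of_bullet \<UU> \<theta> q \<sigma>) \<in> fol_leaves (quotient_of_bullet \<UU> \<theta> q \<sigma>)"
    by (simp add: quotient_of_bullet_def quotient_transversed_def bullet_foliation_def bullet_leaves_def)
  show "dist_transversal (quotient_of_bullet \<UU> \<theta> q \<sigma>)
      \<subseteq> topspace (fol_space (quotient_of_bullet \<UU> \<theta> q \<sigma>))"
    by (auto simp: quotient_of_bullet_def quotient_transversed_def bullet_foliation_def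
        topspace_quotient_topology bullet_Z_slope_iff)
qed

theorem theorem5:
  fixes \<UU> :: "nat filter" and \<theta> :: real and q :: slope
    and \<sigma> :: "real set \<times> real set \<Rightarrow> bullet"
  assumes "nonprincipal_ultrafilter \<UU>"
    and "\<theta> \<notin> \<rat>"
    and "equivariant_section \<UU> \<theta> q \<sigma>"
  shows
    "let R = bullet_reals \<UU>;
         Z = bullet_Z_theta \<UU> \<theta>;
         \<tau> = section_topology \<UU> \<theta> q \<sigma>;
         Q = quotient_of_bullet \<UU> \<theta> q \<sigma>
     in subgroup Z R \<and>
        properly_discontinuous (R\<lparr>carrier := Z\<rparr>) \<tau> (\<lambda>n x. n \<otimes>\<^bsub>R\<^esub> x) \<and>
        (\<forall>n\<in>Z.
           homeomorphic_map \<tau> \<tau> (\<lambda>x. n \<otimes>\<^bsub>R\<^esub> x) \<and>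
           bij_betw (\<lambda>\<Lambda>. (\<lambda>x. n \<otimes>\<^bsub>R\<^esub> x) ` \<Lambda>)
             (topspace ` bullet_leaves \<UU>) (topspace ` bullet_leaves \<UU>) \<and>
           (\<forall>L\<in>bullet_leaves \<UU>. \<forall>x\<in>topspace L. \<forall>y\<in>topspace L.
              leaf_dist \<UU> (n \<otimes>\<^bsub>R\<^esub> x) (n \<otimes>\<^bsub>R\<^esub> y) = leaf_dist \<UU> x y) \<and>
           (\<lambda>x. n \<otimes>\<^bsub>R\<^esub> x) ` bullet_Z_slope \<UU> \<theta> q = bullet_Z_slope \<UU> \<theta> q) \<and>
        foliation_with_transversal Q \<and>
        (\<exists>\<Phi>. (\<forall>r. \<forall>m\<in>bullet_Z_slope \<UU> \<theta> q.
                \<Phi> (orbit_map \<UU> \<theta> (of_standard \<UU> r \<otimes>\<^bsub>R\<^esub> m))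
                  = to_torus r (r * \<theta>) \<otimes>\<^bsub>torus\<^esub> limit_map \<UU> \<theta> q m) \<and>
             foliation_iso Q (kronecker \<theta> q) \<Phi>)"
proof -
  interpret bullet_section \<UU> \<theta> q \<sigma>
    by unfold_locales (fact assms)+
  have "orbit_limit (orbit_map \<UU> \<theta> (of_standard \<UU> r \<otimes>\<^bsub>bullet_reals \<UU>\<^esub> m))
      = to_torus r (r * \<theta>) \<otimes>\<^bsub>torus\<^esub> limit_map \<UU> \<theta> q m"
    if m: "m \<in> bullet_Z_slope \<UU> \<theta> q" for r m
    using m limit_map_eq_line_limit[OF m]
    by (simp add: orbit_limit_orbit_map bullet_Z_slope_iff line_limit_of_standard)
  then show ?thesis
    unfolding Let_def
  proof (intro conjI ballI exI[of _ orbit_limit] allI)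
    fix n assume n: "n \<in> bullet_Z_theta \<UU> \<theta>"
    then have n': "n \<in> carrier (bullet_reals \<UU>)" by (rule bullet_Z_theta_carrier)
    show "homeomorphic_map (section_topology \<UU> \<theta> q \<sigma>) (section_topology \<UU> \<theta> q \<sigma>)
        (\<lambda>x. n \<otimes>\<^bsub>bullet_reals \<UU>\<^esub> x)"
      by (rule homeomorphic_map_translate[OF n])
    show "bij_betw (\<lambda>\<Lambda>. (\<lambda>x. n \<otimes>\<^bsub>bullet_reals \<UU>\<^esub> x) ` \<Lambda>)
        (topspace ` bullet_leaves \<UU>) (topspace ` bullet_leaves \<UU>)"
      by (rule bij_betw_translate_leaves[OF n'])
    show "(\<lambda>x. n \<otimes>\<^bsub>bullet_reals \<UU>\<^esub> x) ` bullet_Z_slope \<UU> \<theta> q = bullet_Z_slope \<UU> \<theta> q"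
      by (rule translate_bullet_Z_slope[OF n])
    fix L x y assume L: "L \<in> bullet_leaves \<UU>" and xy: "x \<in> topspace L" "y \<in> topspace L"
    show "leaf_dist \<UU> (n \<otimes>\<^bsub>bullet_reals \<UU>\<^esub> x) (n \<otimes>\<^bsub>bullet_reals \<UU>\<^esub> y) = leaf_dist \<UU> x y"
      using xy by (intro leaf_dist_translate n' subsetD[OF bullet_leaves_carrier[OF L]])
  qed (rule subgroup_bullet_Z_theta properly_discontinuous_bullet_Z_theta
      foliation_with_transversal_quotient foliation_iso_orbit_limit | assumption)+
qed

end
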